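(* Fix positive constants $\sigma_1>1$, $c$, $B$, $\varepsilon$, $\delta$, $\bar T$, positive reals $\lambda_1,\dots,\lambda_r$ and complex numbers $\mu_1,\dots,\mu_r$ with $\Re\mu_j>0$, and let $\bar S$ be the subclass of the extended Selberg class described in the context. Let $F\in\bar S$ have degree $d_F>0$. Then there is a constant $T_0=T_0(\bar S)>0$ (depending only on the defining constants of $\bar S$, not on $F$, $A$ or $\sigma_0$) such that the following holds. If $A$ and $s_0=\sigma_0+iT$ satisfy $$A>\varepsilon,\qquad T>T_0,\qquad 1/2-\exp(-T^{A})<\sigma_0\le 1/2,$$ then there is a radius $r=r(F)$ with $$\exp(-T^{A})\le r\le \exp(-T^{A-\varepsilon})$$ such that in the region $\{s : |s-s_0|\le r \text{ and } \sigma<1/2\}$ the functions $F(s)$ and $F'(s)$ have the same number of zeros (counted with multiplicity).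
   Context: Write $s=\sigma+it$. The extended Selberg class $S$ consists of not identically vanishing Dirichlet series $F(s)=\sum_{n\ge1}a_n n^{-s}$, absolutely convergent for $\sigma>1$, such that (i) for some $k\in\mathbb N$, $(s-1)^kF(s)$ extends to an entire function of finite order, and (ii) $F$ satisfies a functional equation $\Phi(s)=\omega\overline{\Phi(1-\bar s)}$, where $\Phi(s)=F(s)Q^s\prod_{j=1}^r\Gamma(\lambda_j s+\mu_j)$ with $Q>0$, $\lambda_j>0$, $\Re\mu_j\ge0$, $|\omega|=1$. The degree is $d_F=2\sum_{j=1}^r\lambda_j$. Given positive constants $\sigma_1>1$, $c$, $B$, $\varepsilon$, $\delta$, $\bar T$, positive $\lambda_1,\dots,\lambda_r$ and complex $\mu_1,\dots,\mu_r$ with $\Re\mu_j>0$, the subclass $\bar S\subset S$ consists of those $F\in S$ such that: $|F(\sigma_1+it)|\ge c$ for all real $t$; $|F(\sigma+iT)|<T^{B}$ for all $T>10$ and $\sigma\ge -4\sigma_1$; $F$ satisfies the functional equation above with these fixed $\lambda_j,\mu_j$ (and some $Q>0$ and any $|\omega|=1$); and for every $T>\bar T$, $F$ has at most $\frac{\varepsilon}{\log(2+\delta)}\log T-2$ zeros in the strip $|t-T|\le 1/T$. *)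

theory Defs
  imports "HOL-Complex_Analysis.Complex_Analysis"
begin

definition dirichlet_term :: "(nat \<Rightarrow> complex) \<Rightarrow> complex \<Rightarrow> nat \<Rightarrow> complex" where
  "dirichlet_term a s n = a n * of_nat n powr (- s)"

definition entire_finite_order :: "(complex \<Rightarrow> complex) \<Rightarrow> bool" where
  "entire_finite_order G \<longleftrightarrow>
     G holomorphic_on UNIV \<and>
     (\<exists>\<rho>. \<forall>\<^sub>F z in at_infinity. norm (G z) \<le> exp (norm z powr \<rho>))"

definition completed ::
    "(complex \<Rightarrow> complex) \<Rightarrow> nat \<Rightarrow> (nat \<Rightarrow> real) \<Rightarrow> (nat \<Rightarrow> complex) \<Rightarrow> real \<Rightarrow> complex \<Rightarrow> complex" where
  "completed F r lam mu Q s =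
     F s * of_real Q powr s * (\<Prod>j\<in>{1..r}. Gamma (of_real (lam j) * s + mu j))"

(* The functional equation is an identity of meromorphic functions.  Since functions in HOL are
   total (Gamma, for instance, takes the value 0 at its poles), the pointwise identity is only
   required where no factor on either side can have a pole; the excluded points are isolated. *)
definition functional_equation ::
    "(complex \<Rightarrow> complex) \<Rightarrow> nat \<Rightarrow> (nat \<Rightarrow> real) \<Rightarrow> (nat \<Rightarrow> complex) \<Rightarrow> real \<Rightarrow> complex \<Rightarrow> bool" where
  "functional_equation F r lam mu Q \<omega> \<longleftrightarrow>
     (\<forall>s. s \<noteq> 0 \<and> s \<noteq> 1 \<and>
          (\<forall>j\<in>{1..r}. of_real (lam j) * s + mu j \<notin> \<int>\<^sub>\<le>\<^sub>0 \<and>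
                      of_real (lam j) * (1 - cnj s) + mu j \<notin> \<int>\<^sub>\<le>\<^sub>0) \<longrightarrow>
          completed F r lam mu Q s = \<omega> * cnj (completed F r lam mu Q (1 - cnj s)))"

(* A member F is the meromorphic continuation of its Dirichlet series.  Being nicely meromorphic
   fixes the value at 1, the only possible pole: the limit if it exists, and 0 otherwise. *)
definition extended_selberg_class :: "(complex \<Rightarrow> complex) set" where
  "extended_selberg_class = {F.
     F nicely_meromorphic_on UNIV \<and>
     (\<exists>a. \<forall>s. Re s > 1 \<longrightarrow>
        summable (\<lambda>n. norm (dirichlet_term a s (Suc n))) \<and>
        F s = (\<Sum>n. dirichlet_term a s (Suc n))) \<and>
     (\<exists>s. Re s > 1 \<and> F s \<noteq> 0) \<and>
     (\<exists>(k::nat) G. entire_finite_order G \<and> (\<forall>s. s \<noteq> 1 \<longrightarrow> G s = (s - 1) ^ k * F s)) \<and>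
     (\<exists>r lam mu Q \<omega>.
        (\<forall>j\<in>{1..r}. lam j > 0 \<and> Re (mu j) \<ge> 0) \<and> Q > 0 \<and> norm \<omega> = 1 \<and>
        functional_equation F r lam mu Q \<omega>)}"

definition selberg_degree :: "nat \<Rightarrow> (nat \<Rightarrow> real) \<Rightarrow> real" where
  "selberg_degree r lam = 2 * (\<Sum>j\<in>{1..r}. lam j)"

definition zeros_in :: "(complex \<Rightarrow> complex) \<Rightarrow> complex set \<Rightarrow> complex set" where
  "zeros_in f D = {z \<in> D. f z = 0}"

(* Zeros counted with multiplicity.  Meaningful only if the set of zeros is finite, so every use
   is accompanied by a finiteness statement. *)
definition zero_count :: "(complex \<Rightarrow> complex) \<Rightarrow> complex set \<Rightarrow> nat" where
  "zero_count f D = (\<Sum>z\<in>zeros_in f D. nat (zorder f z))"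

definition selberg_subclass ::
    "real \<Rightarrow> real \<Rightarrow> real \<Rightarrow> real \<Rightarrow> real \<Rightarrow> real \<Rightarrow> nat \<Rightarrow> (nat \<Rightarrow> real) \<Rightarrow> (nat \<Rightarrow> complex) \<Rightarrow>
     (complex \<Rightarrow> complex) set" where
  "selberg_subclass \<sigma>\<^sub>1 c B \<epsilon> \<delta> Tbar r lam mu = {F \<in> extended_selberg_class.
     (\<forall>t. norm (F (Complex \<sigma>\<^sub>1 t)) \<ge> c) \<and>
     (\<forall>T \<sigma>. T > 10 \<and> \<sigma> \<ge> - 4 * \<sigma>\<^sub>1 \<longrightarrow> norm (F (Complex \<sigma> T)) < T powr B) \<and>
     (\<exists>Q \<omega>. Q > 0 \<and> norm \<omega> = 1 \<and> functional_equation F r lam mu Q \<omega>) \<and>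
     (\<forall>T. T > Tbar \<longrightarrow>
        finite (zeros_in F {s. \<bar>Im s - T\<bar> \<le> 1 / T}) \<and>
        real (zero_count F {s. \<bar>Im s - T\<bar> \<le> 1 / T}) \<le> \<epsilon> / ln (2 + \<delta>) * ln T - 2)}"

end

theory Submission
  imports Defs "HOL-Real_Asymp.Real_Asymp"
begin

text \<open>
  On the critical line the functional equation gives \<open>Re (F'/F) = - log Q - \<Sum> \<lambda>\<^sub>j Re \<psi>(\<lambda>\<^sub>j s + \<mu>\<^sub>j)\<close>,
  which is at most \<open>-1\<close> for large \<open>t\<close>, uniformly in the class because \<open>Q\<close> is bounded below.
  Among concentric annuli around \<open>1/2 + i T\<close> whose radii satisfy \<open>r\<^bsub>j+1\<^esub> = r\<^sub>j powr (2 + \<delta>)\<close>, some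
  annulus \<open>a < |s - 1/2 - i T| < b\<close> contains no zero off the line. Split \<open>F'/F\<close> into the
  contributions of the zeros on the line, of the inner zeros and of the rest. To the left of the line,
  on circles slightly larger than \<open>a\<close>, the first two have nonpositive real part (pair \<open>\<rho>\<close> with
  \<open>1 - cnj \<rho>\<close>); the rest has derivative \<open>O(T / b\<^sup>2)\<close>, hence differs from its value on the line by
  \<open>O(a T / b\<^sup>2) = o(1)\<close>. So \<open>Re (F'/F) < 0\<close> on such circles, as well as just to the left of the
  line, and Rouche's theorem equates the numbers of zeros of \<open>F\<close> and \<open>F'\<close>.
\<close>

subsection \<open>Local expansion of the logarithmic derivative\<close>

text \<open>About \<open>\<epsilon> ln T / ln (2 + \<delta>)\<close> radii of the form
  \<open>exp (- L)\<close>, with \<open>L\<close> multiplied by \<open>2 + \<delta>\<close> at each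
  step, fit between the two prescribed radii; this is the source of the bound on the zeros in the
  strip. The obstacle is uniformity in \<open>A > \<epsilon>\<close>:
  \<open>exp (- (T powr (A - \<epsilon>)))\<close> may be as large as about \<open>exp (-1)\<close>,
  far too large for the error \<open>b powr \<delta> * T\<close> to be small. The exponent of the
  largest circle therefore carries an extra factor \<open>(1 + 2 / \<delta>) * ln T\<close>, which
  costs at most half of the annuli when \<open>T\<close> is large. Only circles about a point of the
  critical line are invariant under \<open>s\<close> to \<open>1 - cnj s\<close>, so all estimates
  are centred at \<open>1/2 + i T\<close>; \<open>s0\<close> is within \<open>a\<close> of it, and
  the half-annulus from \<open>2a\<close> to \<open>10a\<close> is thick enough to absorb the shift.
  Zeros may lie on the line itself, so no contour can run along it. The contour is a rectangle whose
  right side stops just short of the line, at a distance that may depend on \<open>F\<close>; all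
  other constants are uniform in the class. Positive degree enters through the growth of the Digamma
  terms, which overtake \<open>- ln Q\<close>.\<close>

lemma zorder_pos_at_zero:
  fixes f :: "complex \<Rightarrow> complex"
  assumes "f holomorphic_on S" "open S" "connected S" "p \<in> S" "\<exists>w\<in>S. f w \<noteq> 0" "f p = 0"
  shows "zorder f p > 0"
  using zorder_exist_zero[OF assms(1-5)] assms(6) by simp

lemma finite_zeros_compact:
  assumes "f holomorphic_on S" "open S" "connected S" "compact K" "K \<subseteq> S" "\<exists>w\<in>S. f w \<noteq> 0"
  shows "finite {z \<in> K. f z = (0 :: complex)}"
proof (cases "f constant_on S")
  case True
  then have "f z \<noteq> 0" if "z \<in> S" for z using that assms(6) unfolding constant_on_def by metis
  then have "{z \<in> K. f z = 0} = {}" using assms(5) by auto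
  then show ?thesis by (metis finite.emptyI)
qed (use holomorphic_compact_finite_zeros assms in blast)

text \<open>By induction, one point \<open>p\<close> at a time: the new quotient
  \<open>g / (z - p) ^ n\<close> is holomorphic off \<open>p\<close>, and near \<open>p\<close> it
  agrees with the local cofactor \<open>zor_poly f p\<close> divided by the product over the old
  points, which removes the singularity.\<close>

lemma holomorphic_factor_out_zeros:
  fixes f :: "complex \<Rightarrow> complex"
  assumes f: "f holomorphic_on S" "open S" "connected S" "\<exists>w\<in>S. f w \<noteq> 0"
    and "finite Z" "Z \<subseteq> S"
  shows "\<exists>g. g holomorphic_on S \<and> (\<forall>z\<in>S. f z = (\<Prod>\<rho>\<in>Z. (z - \<rho>) ^ nat (zorder f \<rho>)) * g z) \<and>
           (\<forall>z\<in>Z. g z \<noteq> 0)"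
  using assms(5,6)
proof (induction rule: finite_induct)
  case empty
  then show ?case using f by auto
next
  case (insert p Z)
  define P where "P = (\<lambda>z. \<Prod>\<rho>\<in>Z. (z - \<rho>) ^ nat (zorder f \<rho>))"
  define n where "n = nat (zorder f p)"
  define u where "u = zor_poly f p"
  have pS: "p \<in> S" and ZS: "Z \<subseteq> S" using insert by auto
  obtain g where g: "g holomorphic_on S" "\<And>z. z \<in> S \<Longrightarrow> f z = P z * g z" "\<And>z. z \<in> Z \<Longrightarrow> g z \<noteq> 0"
    using insert.IH[OF ZS] unfolding P_def by blast
  obtain r where r: "r > 0" "cball p r \<subseteq> S" "u holomorphic_on cball p r"
    "\<And>w. w \<in> cball p r \<Longrightarrow> f w = u w * (w - p) ^ n \<and> u w \<noteq> 0"
    using zorder_exist_zero[OF f(1-3) pS f(4)] unfolding n_def u_def by blast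
  have P0: "P z = 0 \<Longrightarrow> z \<in> Z" for z
    using insert.hyps unfolding P_def by auto
  have Ph: "P holomorphic_on A" for A
    unfolding P_def by (intro holomorphic_intros)
  have "open (S - Z)" using f(2) insert.hyps by (simp add: finite_imp_closed open_Diff)
  then obtain e where e: "e > 0" "ball p e \<subseteq> S - Z"
    using pS insert.hyps by (meson DiffI openE)
  define d where "d = min r e"
  have d: "d > 0" "ball p d \<subseteq> S - Z" "ball p d \<subseteq> cball p r" using e r by (auto simp: d_def)
  define h where "h = (\<lambda>w. if w = p then u p / P p else g w / (w - p) ^ n)"
  have hu: "h w = u w / P w" if "w \<in> ball p d" for w
  proof -
    have "P w \<noteq> 0" using P0 that d by blast
    moreover have "f w = u w * (w - p) ^ n" "f w = P w * g w" using r(4) g(2) d that by blast+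
    ultimately show ?thesis unfolding h_def by (auto simp: field_simps)
  qed
  have "h holomorphic_on ball p d"
  proof -
    have "(\<lambda>w. u w / P w) holomorphic_on ball p d"
      using P0 d r(3) by (intro holomorphic_intros Ph) (auto intro: holomorphic_on_subset)
    then show ?thesis by (rule holomorphic_transform) (simp add: hu)
  qed
  moreover have "h holomorphic_on (S - {p})"
  proof -
    have "(\<lambda>w. g w / (w - p) ^ n) holomorphic_on (S - {p})"
      using g(1) by (intro holomorphic_intros) (auto intro: holomorphic_on_subset)
    then show ?thesis by (rule holomorphic_transform) (auto simp: h_def)
  qed
  ultimately have "h holomorphic_on (ball p d \<union> (S - {p}))"
    using f(2) by (intro holomorphic_on_Un) auto
  moreover have "ball p d \<union> (S - {p}) = S" using d pS by auto
  ultimately have "h holomorphic_on S" by simp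
  moreover have "f z = (\<Prod>\<rho>\<in>insert p Z. (z - \<rho>) ^ nat (zorder f \<rho>)) * h z" if "z \<in> S" for z
  proof (cases "z = p")
    case True
    have "p \<in> ball p d" using d by simp
    then have "P p \<noteq> 0" "f p = u p * (p - p) ^ n" using P0 d r(4) by blast+
    then show ?thesis using True insert.hyps
      by (simp add: h_def P_def n_def)
  next
    case False
    then show ?thesis using insert.hyps g(2)[OF that]
      by (simp add: h_def P_def n_def)
  qed
  moreover have "h z \<noteq> 0" if "z \<in> insert p Z" for z
  proof (cases "z = p")
    case True
    have "p \<in> ball p d" using d by simp
    then show ?thesis using True hu P0 d r(4) by (metis DiffD2 divide_eq_0_iff subsetD)
  next
    case False
    then show ?thesis using that g(3) by (simp add: h_def)
  qed
  ultimately show ?case by blast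
qed

text \<open>Schwarz's lemma applied to \<open>h / (2K - h)\<close>: the condition
  \<open>Re h \<le> K\<close> puts \<open>h\<close> at least as near to 0 as to \<open>2K\<close>,
  so this quotient has modulus at most 1.\<close>

lemma Borel_Caratheodory_0:
  assumes h: "h holomorphic_on ball 0 R" "h 0 = 0" and K: "K > 0"
    and le: "\<And>z. z \<in> ball 0 R \<Longrightarrow> Re (h z) \<le> K" and z: "norm z < R"
  shows "norm (h z) \<le> 2 * K * norm z / (R - norm z)"
proof -
  have R: "R > 0" using z norm_ge_zero[of z] by linarith
  \<comment> \<open>The disc is rescaled to radius 1. The slack \<open>\<eta>\<close> makes the
    bound by 1 strict, as \<open>Schwarz_Lemma\<close> demands, and tends to 0 at the end.\<close>
  define w where "w = (\<lambda>(\<eta>::real) x. h (of_real R * x) / (of_real (2 * K + \<eta>) - h (of_real R * x)))"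
  have main: "norm (h z) * (R - norm z) \<le> (2 * K + \<eta>) * norm z" if "\<eta> > 0" for \<eta>
  proof -
    have in_ball: "of_real R * x \<in> ball 0 R" if "norm x < 1" for x :: complex
      using that R by (simp add: norm_mult)
    have Rew: "norm (h (of_real R * x)) < norm (of_real (2*K+\<eta>) - h (of_real R * x))" if "norm x < 1" for x
    proof -
      have "Re (h (of_real R * x)) \<le> K" using le in_ball that by blast
      then have "(Re (h (of_real R * x)))\<^sup>2 < (2*K+\<eta> - Re (h (of_real R * x)))\<^sup>2"
        using K \<open>\<eta> > 0\<close> by (intro power2_strict_mono) (auto simp: abs_less_iff)
      then show ?thesis unfolding cmod_def by (intro real_sqrt_less_mono) simp
    qed
    have nz: "of_real (2*K+\<eta>) - h (of_real R * x) \<noteq> 0" if "norm x < 1" for x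
      using Rew[OF that] by force
    have "norm (w \<eta> (z / of_real R)) \<le> norm (z / of_real R)"
    proof (rule Schwarz_Lemma(1))
      have "(\<lambda>x. h (of_real R * x)) holomorphic_on ball 0 1"
        by (rule holomorphic_on_compose_gen[OF _ h(1), unfolded o_def])
          (use in_ball in \<open>auto intro!: holomorphic_intros\<close>)
      then show "w \<eta> holomorphic_on ball 0 1"
        unfolding w_def using nz by (intro holomorphic_intros) auto
      show "w \<eta> 0 = 0" by (simp add: w_def h)
      show "norm (w \<eta> x) < 1" if "norm x < 1" for x
        using Rew[OF that] nz[OF that] by (simp add: w_def norm_divide divide_less_eq)
      show "norm (z / of_real R) < 1" using z R by (simp add: norm_divide)
    qed
    then have "norm (h z) / norm (of_real (2*K+\<eta>) - h z) \<le> norm z / R"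
      using R by (simp add: w_def norm_divide)
    moreover have "of_real (2*K+\<eta>) - h z \<noteq> 0" using nz[of "z / of_real R"] z R by (simp add: norm_divide)
    ultimately have "norm (h z) * R \<le> norm z * norm (of_real (2*K+\<eta>) - h z)"
      using R by (simp add: field_simps)
    also have "\<dots> \<le> norm z * ((2*K+\<eta>) + norm (h z))"
    proof -
      have "norm (of_real (2*K+\<eta>) - h z) \<le> norm (of_real (2*K+\<eta>) :: complex) + norm (h z)"
        by (rule norm_triangle_ineq4)
      also have "norm (of_real (2*K+\<eta>) :: complex) = 2*K+\<eta>" 
        unfolding norm_of_real using K \<open>\<eta> > 0\<close> by simp
      finally show ?thesis by (simp add: mult_left_mono)
    qed
    finally show ?thesis by (simp add: algebra_simps)
  qed
  have "norm (h z) * (R - norm z) \<le> 2 * K * norm z"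
  proof (rule field_le_epsilon)
    fix e :: real assume "e > 0"
    have "norm (h z) * (R - norm z) \<le> (2 * K + e / R) * norm z" using main[of "e/R"] \<open>e > 0\<close> R by simp
    also have "\<dots> = 2 * K * norm z + e * (norm z / R)" by (simp add: algebra_simps)
    also have "e * (norm z / R) \<le> e * 1" using z R \<open>e > 0\<close> by (intro mult_left_mono) (auto simp: field_simps)
    finally show "norm (h z) * (R - norm z) \<le> 2 * K * norm z + e" by simp
  qed
  then show ?thesis using z by (simp add: field_simps)
qed

lemma has_field_derivative_prod_linear:
  fixes n :: "complex \<Rightarrow> nat"
  assumes "finite Z" "z \<notin> Z"
  shows "((\<lambda>z. \<Prod>\<rho>\<in>Z. (z - \<rho>) ^ n \<rho>) has_field_derivative
           (\<Prod>\<rho>\<in>Z. (z - \<rho>) ^ n \<rho>) * (\<Sum>\<rho>\<in>Z. of_nat (n \<rho>) / (z - \<rho>))) (at z)"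
  using assms
proof (induction rule: finite_induct)
  case (insert p Z)
  have p: "((\<lambda>z. (z - p) ^ n p) has_field_derivative (z - p) ^ n p * (of_nat (n p) / (z - p))) (at z)"
  proof (cases "n p")
    case (Suc k)
    have "((\<lambda>z. (z - p) ^ Suc k) has_field_derivative of_nat (Suc k) * (z - p) ^ k) (at z)"
      by (rule derivative_eq_intros refl)+ simp
    moreover have "(z - p) ^ Suc k * (of_nat (Suc k) / (z - p)) = of_nat (Suc k) * (z - p) ^ k"
      using insert by simp
    ultimately show ?thesis unfolding Suc by (simp only:)
  qed auto
  show ?case
    using DERIV_mult[OF p insert.IH] insert by (auto simp: algebra_simps)
qed auto

lemma prod_linear_norm:
  fixes n :: "complex \<Rightarrow> nat"
  assumes "finite Z"
  shows "(\<And>\<rho>. \<rho> \<in> Z \<Longrightarrow> norm (z - \<rho>) \<le> d) \<Longrightarrow> norm (\<Prod>\<rho>\<in>Z. (z - \<rho>) ^ n \<rho>) \<le> d ^ sum n Z"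
    and "d \<ge> 0 \<Longrightarrow> (\<And>\<rho>. \<rho> \<in> Z \<Longrightarrow> d \<le> norm (z - \<rho>)) \<Longrightarrow> d ^ sum n Z \<le> norm (\<Prod>\<rho>\<in>Z. (z - \<rho>) ^ n \<rho>)"
  by (auto simp: power_sum norm_power simp flip: prod_norm intro!: prod_mono power_mono)

text \<open>Each factor \<open>z - \<rho>\<close> has modulus at least \<open>2R\<close> on the
  sphere of radius \<open>3R\<close> but at most \<open>R\<close> at \<open>c\<close>. Once these
  factors are divided out, the maximum principle gains \<open>2 ^ N\<close>: this bounds the number
  \<open>N\<close> of zeros as in Jensen's formula, and leaves a quotient \<open>g\<close> without
  zeros on \<open>cball c R\<close>, for which \<open>ln |g / g c| \<le> K\<close> on the open ball.
  \<open>q\<close> is the derivative of \<open>ln (g / g c)\<close>.\<close>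

lemma logderiv_local_expansion:
  fixes f :: "complex \<Rightarrow> complex"
  assumes f: "f holomorphic_on S" "open S" "connected S" "cball c (3 * R) \<subseteq> S" "R > 0"
    and m: "m > 0" "m \<le> norm (f c)" and M: "\<And>z. z \<in> sphere c (3 * R) \<Longrightarrow> norm (f z) \<le> M"
    and K: "K > 0" "ln (M / m) \<le> K"
    and Z: "Z = {z \<in> cball c R. f z = 0}"
  shows "finite Z" and "ln 2 * (\<Sum>\<rho>\<in>Z. nat (zorder f \<rho>)) \<le> K"
    and "\<exists>q. q holomorphic_on ball c R \<and>
           (\<forall>z \<in> ball c R. f z \<noteq> 0 \<longrightarrow>
              deriv f z / f z = (\<Sum>\<rho>\<in>Z. of_nat (nat (zorder f \<rho>)) / (z - \<rho>)) + q z) \<and>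
           (\<forall>z \<in> cball c (2 / 3 * R). norm (deriv q z) \<le> 792 * K / R\<^sup>2)"
proof -
  have cS: "c \<in> S" "cball c R \<subseteq> S" and fc: "f c \<noteq> 0" using f m by auto
  show fin: "finite Z"
    unfolding Z using cS fc by (intro finite_zeros_compact[OF f(1-3)]) auto
  have ZS: "Z \<subseteq> S" and cZ: "c \<notin> Z" using Z cS fc by auto
  define n where "n = (\<lambda>\<rho>. nat (zorder f \<rho>))"
  define N where "N = sum n Z"
  define P where "P = (\<lambda>z. \<Prod>\<rho>\<in>Z. (z - \<rho>) ^ n \<rho>)"
  obtain g where g: "g holomorphic_on S" "\<And>z. z \<in> S \<Longrightarrow> f z = P z * g z" "\<And>z. z \<in> Z \<Longrightarrow> g z \<noteq> 0"
    using holomorphic_factor_out_zeros[OF f(1-3) _ fin ZS] cS fc unfolding P_def n_def by blast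
  have g0: "g z \<noteq> 0" if "z \<in> cball c R" for z
    using g(2)[of z] g(3)[of z] that cS Z by (cases "f z = 0") auto
  have gM: "norm (g z) \<le> M / (2 * R) ^ N" if "z \<in> cball c (3 * R)" for z
  proof (rule maximum_modulus_frontier[where f = g and S = "cball c (3*R)" and \<xi> = z])
    show "g holomorphic_on interior (cball c (3 * R))"
      using holomorphic_on_subset[OF g(1)] f(4) ball_subset_cball[of c "3 * R"]
      by (metis interior_cball subset_trans)
    show "continuous_on (closure (cball c (3 * R))) g"
      using g(1) f(4) by (auto intro!: holomorphic_on_imp_continuous_on intro: holomorphic_on_subset)
    fix w assume "w \<in> frontier (cball c (3 * R))"
    then have w: "w \<in> sphere c (3 * R)" using f(5) by simp
    have "(2 * R) ^ N \<le> norm (P w)" unfolding P_def N_def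
    proof (rule prod_linear_norm(2)[OF fin])
      fix \<rho> assume "\<rho> \<in> Z"
      then have "dist c \<rho> \<le> R" "dist c w = 3 * R" using Z w by auto
      then show "2 * R \<le> norm (w - \<rho>)" using dist_triangle[of c w \<rho>] by (simp add: dist_norm norm_minus_commute)
    qed (use f in simp)
    then have "(2 * R) ^ N * norm (g w) \<le> norm (f w)"
      using g(2)[of w] w f(4) by (subst g(2)) (auto simp: norm_mult intro: mult_right_mono)
    also have "\<dots> \<le> M" using M w by blast
    finally show "norm (g w) \<le> M / (2 * R) ^ N" using f(5) by (simp add: field_simps)
  qed (use that in auto)
  have gc: "m / R ^ N \<le> norm (g c)"
  proof -
    have "norm (P c) \<le> R ^ N" unfolding P_def N_def
      using Z by (intro prod_linear_norm(1)[OF fin]) (auto simp: dist_norm)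
    then have "norm (f c) \<le> R ^ N * norm (g c)" using g(2)[OF cS(1)] by (simp add: norm_mult mult_right_mono)
    then show ?thesis using m f(5) by (simp add: field_simps)
  qed
  have gz: "norm (g z) \<le> M / m / 2 ^ N * norm (g c)" if "z \<in> cball c (3 * R)" for z
  proof -
    have Mp: "0 \<le> M / (2 * R) ^ N" using gM[OF that] norm_ge_zero order_trans by blast
    have "(2 * R) ^ N > 0" using f(5) by simp
    then have "M \<ge> 0" using Mp by (metis not_le zero_le_divide_iff)
    have "norm (g z) \<le> M / (2 * R) ^ N" by (rule gM[OF that])
    also have "\<dots> = M / m / 2 ^ N * (m / R ^ N)" using m by (simp add: power_mult_distrib)
    also have "\<dots> \<le> M / m / 2 ^ N * norm (g c)"
      using gc \<open>M \<ge> 0\<close> m by (intro mult_left_mono) auto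
    finally show ?thesis .
  qed
  have gcp: "norm (g c) > 0" using gc m f(5) by (meson divide_pos_pos less_le_trans zero_less_power)
  have "norm (g c) \<le> M / m / 2 ^ N * norm (g c)" using gz[of c] f(5) by simp
  then have N2: "2 ^ N \<le> M / m" using gcp m by (simp add: field_simps)
  have Mm: "M / m > 0" using less_le_trans[OF _ N2] by simp
  have "ln (2 ^ N) \<le> ln (M / m)" using N2 by (intro ln_mono) auto
  then have "ln 2 * N \<le> K" using K by (simp add: ln_realpow mult.commute)
  then show "ln 2 * (\<Sum>\<rho>\<in>Z. nat (zorder f \<rho>)) \<le> K" by (simp add: N_def n_def)
  have gz': "norm (g z / g c) \<le> M / m" if "z \<in> ball c R" for z
  proof -
    have "norm (g z) \<le> M / m / 2 ^ N * norm (g c)" using gz[of z] that f(5) by simp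
    then have "norm (g z / g c) \<le> M / m / 2 ^ N" using gcp by (simp add: norm_divide field_simps)
    also have "\<dots> \<le> M / m / 1" using Mm by (intro divide_left_mono) auto
    finally show ?thesis by simp
  qed
  have gball: "g holomorphic_on ball c R"
    using g(1) cS(2) by (meson ball_subset_cball holomorphic_on_subset)
  obtain h0 where h0: "h0 holomorphic_on ball c R" "\<And>z. z \<in> ball c R \<Longrightarrow> exp (h0 z) = g z"
    using holomorphic_logarithm_exists[of "ball c R" g c] gball g0 f(5) by auto
  define h where "h = (\<lambda>z. h0 z - h0 c)"
  have h: "h holomorphic_on ball c R" unfolding h_def by (intro holomorphic_intros h0)
  have hexp: "exp (h z) = g z / g c" if "z \<in> ball c R" for z
    using h0(2)[OF that] h0(2)[of c] f(5) by (simp add: h_def exp_diff)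
  have hRe: "Re (h z) \<le> K" if "z \<in> ball c R" for z
  proof -
    have "exp (Re (h z)) \<le> M / m" using hexp[OF that] gz'[OF that] by (metis norm_exp_eq_Re)
    then have "Re (h z) \<le> ln (M / m)" using Mm by (simp add: ln_ge_iff)
    then show ?thesis using K by simp
  qed
  \<comment> \<open>At radius \<open>5/6 R\<close> the bound is
    \<open>2K * (5/6) / (1/6) = 10K\<close>. It is relaxed to a strict \<open>11K\<close> because
    \<open>Cauchy_higher_deriv_bound\<close> wants values in an open ball.\<close>
  have hbound: "norm (h z) < 11 * K" if "norm (z - c) \<le> 5 / 6 * R" for z
  proof -
    have "norm (h (c + (z - c))) \<le> 2 * K * norm (z - c) / (R - norm (z - c))"
    proof (rule Borel_Caratheodory_0[of "\<lambda>x. h (c + x)"])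
      show "(\<lambda>x. h (c + x)) holomorphic_on ball 0 R"
        by (rule holomorphic_on_compose_gen[OF _ h, unfolded o_def])
          (auto intro!: holomorphic_intros simp: dist_norm)
      show "Re (h (c + x)) \<le> K" if "x \<in> ball 0 R" for x
        using that by (intro hRe) (simp add: dist_norm)
    qed (use that f(5) K in \<open>auto simp: h_def\<close>)
    also have "\<dots> \<le> 10 * K"
    proof -
      have "R - norm (z - c) > 0" using that f(5) by linarith
      moreover have "2 * K * norm (z - c) \<le> 10 * K * (R - norm (z - c))"
      proof -
        have "K * (10 * (R - norm (z - c)) - 2 * norm (z - c)) \<ge> 0"
          using that K by (intro mult_nonneg_nonneg) auto
        then show ?thesis by (simp add: algebra_simps)
      qed
      ultimately show ?thesis by (simp add: field_simps)
    qed
    also have "\<dots> < 11 * K" using K by simp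
    finally show ?thesis by simp
  qed
  define q where "q = deriv h"
  have q: "q holomorphic_on ball c R" unfolding q_def using h by (intro holomorphic_deriv) auto
  have qg: "deriv g z = q z * g z" if "z \<in> ball c R" for z
  proof -
    have "(h has_field_derivative q z) (at z)" unfolding q_def
      using h that by (simp add: holomorphic_derivI)
    then have "((\<lambda>z. g c * exp (h z)) has_field_derivative g c * (exp (h z) * q z)) (at z)"
      by (auto intro!: derivative_eq_intros)
    moreover have "\<forall>\<^sub>F x in nhds z. g c * exp (h x) = g x"
      using eventually_nhds_in_open[of "ball c R" z] that gcp
      by (auto elim!: eventually_mono simp del: mem_ball simp: hexp)
    ultimately have "(g has_field_derivative g c * (exp (h z) * q z)) (at z)"
      by (rule DERIV_cong_ev[OF refl _ refl, THEN iffD1, rotated])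
    then show ?thesis using hexp[OF that] gcp by (simp add: DERIV_imp_deriv)
  qed
  have "deriv f z / f z = (\<Sum>\<rho>\<in>Z. of_nat (n \<rho>) / (z - \<rho>)) + q z" if "z \<in> ball c R" "f z \<noteq> 0" for z
  proof -
    have zS: "z \<in> S" using that cS(2) by auto
    have zZ: "z \<notin> Z" using that Z by auto
    have dg: "(g has_field_derivative q z * g z) (at z)"
      using holomorphic_derivI[OF g(1) f(2) zS] qg that by simp
    have "((\<lambda>z. P z * g z) has_field_derivative P z * (\<Sum>\<rho>\<in>Z. of_nat (n \<rho>) / (z - \<rho>)) * g z + q z * g z * P z) (at z)"
      by (rule DERIV_mult[OF _ dg]) (unfold P_def, rule has_field_derivative_prod_linear[OF fin zZ])
    moreover have "\<forall>\<^sub>F x in nhds z. P x * g x = f x"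
      using eventually_nhds_in_open[OF f(2) zS] by eventually_elim (simp add: g(2))
    ultimately have "(f has_field_derivative P z * (\<Sum>\<rho>\<in>Z. of_nat (n \<rho>) / (z - \<rho>)) * g z + q z * g z * P z) (at z)"
      by (rule DERIV_cong_ev[OF refl _ refl, THEN iffD1, rotated])
    then have "deriv f z = P z * (\<Sum>\<rho>\<in>Z. of_nat (n \<rho>) / (z - \<rho>)) * g z + q z * g z * P z"
      by (rule DERIV_imp_deriv)
    moreover have "(p * s * u + v * u * p) / (p * u) = s + v" if "p \<noteq> 0" "u \<noteq> 0" for p s u v :: complex
      using that by (simp add: field_simps)
    ultimately show ?thesis using that(2) g(2)[OF zS] by simp
  qed
  moreover have "norm (deriv q z) \<le> 792 * K / R\<^sup>2" if "z \<in> cball c (2 / 3 * R)" for z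
  proof -
    have sub: "cball z (R / 6) \<subseteq> ball c R" 
    proof
      fix x assume "x \<in> cball z (R / 6)"
      then show "x \<in> ball c R" using that f(5) dist_triangle[of c x z] by simp
    qed
    \<comment> \<open>Since \<open>2/3 + 1/6 = 5/6\<close>, circles of radius \<open>R / 6\<close>
      stay where \<open>hbound\<close> applies; \<open>2 * 11 * 36\<close> is the 792 of the
      statement.\<close>
    have "norm ((deriv ^^ 2) h z) \<le> fact 2 * (11 * K) / (R / 6) ^ 2"
    proof (rule Cauchy_higher_deriv_bound[where y = 0])
      show "h holomorphic_on ball z (R / 6)" using h sub ball_subset_cball by (meson holomorphic_on_subset order_trans)
      show "continuous_on (cball z (R / 6)) h" using h sub by (meson holomorphic_on_imp_continuous_on holomorphic_on_subset)
      show "h w \<in> ball 0 (11 * K)" if "w \<in> ball z (R / 6)" for w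
      proof -
        have "dist c w \<le> 5 / 6 * R" using that \<open>z \<in> cball c (2 / 3 * R)\<close> dist_triangle[of c w z] by auto
        then show ?thesis using hbound[of w] by (simp add: dist_norm norm_minus_commute)
      qed
    qed (use f(5) in auto)
    then show ?thesis by (simp add: q_def numeral_2_eq_2 power_divide field_simps)
  qed
  ultimately show "\<exists>q. q holomorphic_on ball c R \<and>
           (\<forall>z \<in> ball c R. f z \<noteq> 0 \<longrightarrow>
              deriv f z / f z = (\<Sum>\<rho>\<in>Z. of_nat (nat (zorder f \<rho>)) / (z - \<rho>)) + q z) \<and>
           (\<forall>z \<in> cball c (2 / 3 * R). norm (deriv q z) \<le> 792 * K / R\<^sup>2)"
    using q unfolding n_def by blast
qed

subsection \<open>The digamma function high up in the right half plane\<close>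

text \<open>A crude substitute for Stirling, from the series with terms
  \<open>1 / (k + 1) - 1 / (z + k)\<close>. For \<open>k < N\<close> the height of \<open>z\<close>
  gives \<open>Re (1 / (z + k)) \<le> 1 / N\<close>, a total loss of at most 1; for
  \<open>k \<ge> N\<close> the bound \<open>1 / k\<close> makes the tail telescope, a loss of at
  most \<open>1 / N\<close>. Euler's constant accounts for the third unit.\<close>

lemma Re_Digamma_ge:
  fixes z :: complex
  assumes x: "Re z > 0" and N: "N > 0" "real N \<le> Im z"
  shows "Re (Digamma z) \<ge> ln (real N + 1) - 3"
proof -
  define t where "t = (\<lambda>k. inverse (of_nat (Suc k)) - inverse (z + of_nat k))"
  have z0: "z \<noteq> 0" using x by auto
  have y: "Im z > 0" using N by linarith
  have Ret: "Re (t k) = 1 / real (Suc k) - Re (inverse (z + of_nat k))" for k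
  proof -
    have "inverse (of_nat (Suc k)) = complex_of_real (1 / real (Suc k))"
      by (simp add: inverse_eq_divide)
    then show ?thesis unfolding t_def by (simp only: minus_complex.sel Re_complex_of_real)
  qed
  have b1: "Re (inverse (z + of_nat k)) \<le> 1 / real N" for k
  proof -
    have "Re (inverse (z + of_nat k)) \<le> norm (inverse (z + of_nat k))" by (rule complex_Re_le_cmod)
    also have "\<dots> = 1 / norm (z + of_nat k)" by (metis norm_inverse inverse_eq_divide)
    also have "\<dots> \<le> 1 / real N"
    proof -
      have "real N \<le> \<bar>Im (z + of_nat k)\<bar>" using N by simp
      also have "\<dots> \<le> norm (z + of_nat k)" by (rule abs_Im_le_cmod)
      finally show ?thesis using N(1) by (simp add: frac_le)
    qed
    finally show ?thesis .
  qed
  have b2: "Re (inverse (z + of_nat k)) \<le> 1 / real k" if "k > 0" for k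
  proof -
    have "Re (inverse (z + of_nat k)) \<le> norm (inverse (z + of_nat k))" by (rule complex_Re_le_cmod)
    also have "\<dots> = 1 / norm (z + of_nat k)" by (metis norm_inverse inverse_eq_divide)
    also have "\<dots> \<le> 1 / real k"
    proof -
      have "real k \<le> \<bar>Re (z + of_nat k)\<bar>" using x by simp
      also have "\<dots> \<le> norm (z + of_nat k)" by (rule abs_Re_le_cmod)
      finally show ?thesis using that by (simp add: frac_le)
    qed
    finally show ?thesis .
  qed
  have head: "(\<Sum>k<N. Re (t k)) \<ge> harm N - 1"
  proof -
    have "(\<Sum>k<N. 1 / real (Suc k) - 1 / real N) \<le> (\<Sum>k<N. Re (t k))"
      unfolding Ret by (intro sum_mono diff_mono b1 order_refl)
    moreover have "(\<Sum>k<N. 1 / real (Suc k)) = harm N"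
      unfolding harm_def by (simp add: sum.atLeast1_atMost_eq inverse_eq_divide del: of_nat_Suc)
    ultimately show ?thesis using N by (simp add: sum_subtractf)
  qed
  have part: "(\<Sum>k<n. Re (t k)) \<ge> harm N - 2" if "n \<ge> N" for n
  proof -
    have "(\<Sum>k<n. Re (t k)) \<ge> harm N - 1 - 1 / real N + 1 / real n" using that
    proof (induction rule: dec_induct)
      case base
      then show ?case using head by simp
    next
      case (step n)
      then have "n > 0" using N by simp
      then show ?case using step b2[of n] Ret[of n] by simp
    qed
    moreover have "1 / real N \<le> 1" "1 / real n \<ge> 0" using N by auto
    ultimately show ?thesis by linarith
  qed
  have "t sums (\<Sum>k. t k)" unfolding t_def using summable_Digamma[OF z0] by (rule summable_sums)
  then have "(\<lambda>k. Re (t k)) sums Re (\<Sum>k. t k)" by (rule sums_Re)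
  then have "Re (\<Sum>k. t k) \<ge> harm N - 2"
    unfolding sums_def using part by (intro LIMSEQ_le_const) auto
  moreover have "Digamma z = (\<Sum>k. t k) - euler_mascheroni" unfolding t_def by (rule Digamma_def)
  moreover have "Re (euler_mascheroni :: complex) \<le> 1"
  proof -
    have "(euler_mascheroni :: complex) = of_real euler_mascheroni" by simp
    then have "Re (euler_mascheroni :: complex) = euler_mascheroni" by (metis Re_complex_of_real)
    then show ?thesis using euler_mascheroni_less_13_over_22 by simp
  qed
  moreover have "ln (real N + 1) \<le> harm N" by (rule ln_le_harm)
  ultimately show ?thesis by simp
qed

subsection \<open>Consequences of the functional equation\<close>

text \<open>\<open>T1\<close> is a height above which no Gamma argument is real, whatever
  \<open>Re s\<close>. A condition on \<open>Im s\<close> alone is preserved by \<open>s\<close> to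
  \<open>1 - cnj s\<close>, so both sides of the functional equation are covered at once.\<close>

locale gamma_data =
  fixes r :: nat and lam :: "nat \<Rightarrow> real" and mu :: "nat \<Rightarrow> complex" and T1 :: real
  assumes lam_pos: "j \<in> {1..r} \<Longrightarrow> lam j > 0"
    and mu_pos: "j \<in> {1..r} \<Longrightarrow> Re (mu j) > 0"
    and T1: "T1 > 10"
    and Im_arg_pos: "j \<in> {1..r} \<Longrightarrow> t \<ge> T1 \<Longrightarrow> lam j * t + Im (mu j) > 0"
begin

definition gam :: "complex \<Rightarrow> complex" where
  "gam s = (\<Prod>j\<in>{1..r}. Gamma (of_real (lam j) * s + mu j))"

lemma arg_not_nonpos: "j \<in> {1..r} \<Longrightarrow> Im s \<ge> T1 \<Longrightarrow> of_real (lam j) * s + mu j \<notin> \<int>\<^sub>\<le>\<^sub>0"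
  using Im_arg_pos[of j "Im s"] by (auto elim!: nonpos_Ints_cases simp: complex_eq_iff)

lemma gam_nz: "Im s \<ge> T1 \<Longrightarrow> gam s \<noteq> 0"
  unfolding gam_def using arg_not_nonpos by (auto simp: Gamma_eq_zero_iff)

lemma gam_holo: "gam holomorphic_on {s. Im s \<ge> T1}"
  unfolding gam_def using arg_not_nonpos by (intro holomorphic_intros) auto

end

lemma gamma_data_exists:
  assumes "\<And>j. j \<in> {1..r} \<Longrightarrow> lam j > (0 :: real)" "\<And>j. j \<in> {1..r} \<Longrightarrow> Re (mu j) > 0"
  obtains T1 where "gamma_data r lam mu T1"
proof -
  define S where "S = (\<Sum>j\<in>{1..r}. \<bar>Im (mu j)\<bar> / lam j)"
  have "gamma_data r lam mu (11 + S)"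
  proof
    have "S \<ge> 0" unfolding S_def using assms by (intro sum_nonneg) (auto simp: less_imp_le)
    then show "11 + S > 10" by simp
    fix j t assume j: "j \<in> {1..r}" and t: "11 + S \<le> t"
    have "\<bar>Im (mu j)\<bar> / lam j \<le> S" unfolding S_def
      using assms j by (intro member_le_sum) (auto simp: less_imp_le)
    then have "\<bar>Im (mu j)\<bar> / lam j < t" using t by simp
    then have "\<bar>Im (mu j)\<bar> < lam j * t" using assms(1)[OF j] by (simp add: field_simps)
    then show "lam j * t + Im (mu j) > 0" by linarith
  qed (use assms in auto)
  then show ?thesis by (rule that)
qed

text \<open>Above height \<open>T1\<close> none of the Gamma factors has a pole, so the functional equation
  holds there without exceptions.\<close>
locale completed_fn = gamma_data +
  fixes F :: "complex \<Rightarrow> complex" and Q :: real and \<omega> :: complex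
  assumes F_holo: "F holomorphic_on - {1}" and Q: "Q > 0" and \<omega>: "norm \<omega> = 1"
    and fe: "functional_equation F r lam mu Q \<omega>"
begin

definition E :: "complex \<Rightarrow> complex" where "E s = of_real Q powr s * gam s"

lemma E_nz: "Im s \<ge> T1 \<Longrightarrow> E s \<noteq> 0"
  using gam_nz Q by (simp add: E_def)

lemma E_holo: "E holomorphic_on {s. Im s \<ge> T1}"
  unfolding E_def using Q by (intro holomorphic_intros gam_holo) auto

lemma FE: 
  assumes "Im s \<ge> T1"
  shows "F s * E s = \<omega> * cnj (F (1 - cnj s) * E (1 - cnj s))"
proof -
  have "s \<noteq> 0" "s \<noteq> 1" using assms T1 by auto
  moreover have "\<forall>j\<in>{1..r}. of_real (lam j) * s + mu j \<notin> \<int>\<^sub>\<le>\<^sub>0 \<and>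
                      of_real (lam j) * (1 - cnj s) + mu j \<notin> \<int>\<^sub>\<le>\<^sub>0"
    using arg_not_nonpos assms by auto
  ultimately have "completed F r lam mu Q s = \<omega> * cnj (completed F r lam mu Q (1 - cnj s))"
    using fe unfolding functional_equation_def by blast
  then show ?thesis
    unfolding completed_def E_def gam_def by (simp only: mult.assoc)
qed

text \<open>Schwarz reflection in the critical line: the two conjugations cancel, so the reflected
  function is holomorphic. The strict inequality makes the half-plane open, which
  \<open>holomorphic_on_compose_cnj_cnj\<close> needs.\<close>

lemma reflected_holo: "(\<lambda>w. cnj (f (1 - cnj w))) holomorphic_on {s. Im s > T1}"
  if "f holomorphic_on {s. Im s \<ge> T1}" for f
proof -
  have "(\<lambda>u. f (1 - u)) holomorphic_on cnj ` {s. Im s > T1}"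
    by (rule holomorphic_on_compose_gen[OF _ that, unfolded o_def]) (auto intro!: holomorphic_intros)
  then have "cnj \<circ> (\<lambda>u. f (1 - u)) \<circ> cnj holomorphic_on {s. Im s > T1}"
    by (intro holomorphic_on_compose_cnj_cnj) (auto simp: open_halfspace_Im_gt)
  then show ?thesis by (simp add: o_def)
qed

lemma zero_symmetric:
  assumes "Im p \<ge> T1" "F p = 0" shows "F (1 - cnj p) = 0"
  using FE[OF assms(1)] E_nz[of "1 - cnj p"] assms \<omega> by (auto simp: norm_eq_zero)

text \<open>The functional equation writes \<open>F w\<close> as a zero-free holomorphic factor
  times \<open>cnj (F (1 - cnj w))\<close>. Under the reflection the local factorisation at
  \<open>p\<close> becomes one at \<open>1 - cnj p\<close>, because
  \<open>cnj ((1 - cnj w) - p) = - (w - q)\<close>; the sign goes into the cofactor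
  \<open>k\<close>.\<close>

lemma zorder_symmetric:
  assumes p: "Im p > T1" and nz: "\<exists>w. w \<noteq> 1 \<and> F w \<noteq> 0"
  shows "zorder F (1 - cnj p) = zorder F p"
proof -
  define n where "n = zorder F p"
  have conn: "connected (- {1 :: complex})" by (intro connected_punctured_universe) auto
  have pS: "p \<in> - {1}" using p T1 by auto
  obtain h e where e: "e > 0" "cball p e \<subseteq> - {1}" "h holomorphic_on cball p e"
    and h: "\<And>w. w \<in> cball p e \<Longrightarrow> F w = h w * (w - p) ^ nat n \<and> h w \<noteq> 0" and n: "n \<ge> 0"
  proof -
    have "\<exists>w\<in>- {1}. F w \<noteq> 0" "open (- {1 :: complex})" using nz by auto
    note z = zorder_exist_zero[OF F_holo this(2) conn pS this(1)]
    then have "n \<ge> 0" unfolding n_def by (auto split: if_splits)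
    with z that show ?thesis unfolding n_def by blast
  qed
  define d where "d = min e (Im p - T1)"
  have d: "d > 0" "ball p d \<subseteq> cball p e" using e p by (auto simp: d_def)
  define q where "q = 1 - cnj p"
  have refl: "1 - cnj w \<in> ball p d" if "w \<in> ball q d" for w
  proof -
    have "dist q w = norm (cnj (1 - cnj p - w))" unfolding q_def dist_norm by (simp only: complex_mod_cnj)
    also have "cnj (1 - cnj p - w) = (1 - cnj w) - p" by (simp add: algebra_simps)
    finally show ?thesis using that by (simp add: dist_norm norm_minus_commute)
  qed
  have Imw: "Im w > T1" if "w \<in> ball q d" for w
  proof -
    have "\<bar>Im (q - w)\<bar> < d" using that abs_Im_le_cmod[of "q - w"] by (simp add: dist_norm)
    then show ?thesis unfolding d_def q_def by (auto simp: abs_less_iff)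
  qed
  define k where "k = (\<lambda>w. \<omega> * cnj (E (1 - cnj w)) / E w * cnj (h (1 - cnj w)) * (- 1) ^ nat n)"
  have "zorder F q = n"
  proof (rule zorder_eqI[of "ball q d" _ k])
    have hr: "(\<lambda>w. cnj (h (1 - cnj w))) holomorphic_on ball q d"
    proof -
      have "(\<lambda>u. h (1 - u)) holomorphic_on cnj ` ball q d"
        using refl by (intro holomorphic_on_compose_gen[OF _ holomorphic_on_subset[OF e(3) d(2)], unfolded o_def])
           (auto intro!: holomorphic_intros)
      then have "cnj \<circ> (\<lambda>u. h (1 - u)) \<circ> cnj holomorphic_on ball q d"
        by (intro holomorphic_on_compose_cnj_cnj) auto
      then show ?thesis by (simp add: o_def)
    qed
    have Er: "(\<lambda>w. cnj (E (1 - cnj w))) holomorphic_on ball q d"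
      by (rule holomorphic_on_subset[OF reflected_holo[OF E_holo]]) (use Imw in auto)
    have Eh: "E holomorphic_on ball q d" 
      by (rule holomorphic_on_subset[OF E_holo]) (use Imw in \<open>auto simp: less_imp_le\<close>)
    have Ez: "E w \<noteq> 0" if "w \<in> ball q d" for w using E_nz Imw[OF that] by (simp add: less_imp_le)
    show "k holomorphic_on ball q d"
      unfolding k_def by (intro holomorphic_intros hr Er Eh Ez)
    have "q \<in> ball q d" using d by simp
    then have "h (1 - cnj q) \<noteq> 0" "E (1 - cnj q) \<noteq> 0" "E q \<noteq> 0"
      using h refl[of q] d E_nz[of "1 - cnj q"] Imw[of q] Ez by auto
    then show "k q \<noteq> 0" using \<omega> unfolding k_def by auto
    fix w assume w: "w \<in> ball q d"
    have "F w = \<omega> * cnj (E (1 - cnj w)) / E w * cnj (F (1 - cnj w))"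
      using FE[of w] Imw[OF w] Ez[OF w] by (simp add: field_simps)
    also have "F (1 - cnj w) = h (1 - cnj w) * ((1 - cnj w) - p) ^ nat n" 
      using h refl[OF w] d by blast
    also have "cnj \<dots> = cnj (h (1 - cnj w)) * ((- 1) * (w - q)) ^ nat n"
      by (simp add: q_def algebra_simps)
    also have "((- 1) * (w - q)) ^ nat n = (-1) ^ nat n * (w - q) powi n"
      unfolding power_mult_distrib using n by (simp add: power_int_def)
    finally show "F w = k w * (w - q) powi n" by (simp add: k_def)
  qed (use d in auto)
  then show ?thesis by (simp add: q_def n_def)
qed

text \<open>A point \<open>s\<close> of the line is fixed by the reflection. Differentiating the
  functional equation of \<open>\<Phi> = F * E\<close> there gives
  \<open>\<Phi>' = - \<omega> * cnj \<Phi>'\<close>, while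
  \<open>\<Phi> = \<omega> * cnj \<Phi>\<close>; hence \<open>\<Phi>' / \<Phi>\<close> is purely
  imaginary and \<open>Re (F' / F) = - Re (E' / E)\<close>.\<close>

lemma Re_logderiv_on_line:
  assumes t: "t > T1" and nz: "F (Complex (1/2) t) \<noteq> 0"
  shows "Re (deriv F (Complex (1/2) t) / F (Complex (1/2) t)) =
           - ln Q - (\<Sum>j\<in>{1..r}. lam j * Re (Digamma (of_real (lam j) * Complex (1/2) t + mu j)))"
proof -
  define s where "s = Complex (1/2) t"
  define D where "D = of_real (ln Q) + (\<Sum>j\<in>{1..r}. of_real (lam j) * Digamma (of_real (lam j) * s + mu j))"
  define \<Phi> where "\<Phi> = (\<lambda>s. F s * E s)"
  have s: "1 - cnj s = s" "Im s = t" by (auto simp: s_def complex_eq_iff)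
  have s1: "s \<noteq> 1" using s(2) t T1 by auto
  have Fd: "(F has_field_derivative deriv F s) (at s)"
    using holomorphic_derivI[OF F_holo, of s] s1 by auto
  have gd: "(gam has_field_derivative gam s * (\<Sum>j\<in>{1..r}. of_real (lam j) * Digamma (of_real (lam j) * s + mu j))) (at s)"
  proof -
    have nzG: "Gamma (of_real (lam j) * s + mu j) \<noteq> 0" if "j \<in> {1..r}" for j
      using arg_not_nonpos[OF that, of s] s t by (simp add: Gamma_eq_zero_iff)
    have "((\<lambda>u. \<Prod>j\<in>{1..r}. Gamma (of_real (lam j) * u + mu j)) has_field_derivative
            (\<Prod>j\<in>{1..r}. Gamma (of_real (lam j) * s + mu j)) * (\<Sum>j\<in>{1..r}. 
               (Gamma (of_real (lam j) * s + mu j) * Digamma (of_real (lam j) * s + mu j) * of_real (lam j))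
                  / Gamma (of_real (lam j) * s + mu j))) (at s)"
      using arg_not_nonpos[of _ s] s t
      by (intro has_field_derivative_prod' nzG) (auto intro!: derivative_eq_intros)
    also have "(\<Sum>j\<in>{1..r}. 
               (Gamma (of_real (lam j) * s + mu j) * Digamma (of_real (lam j) * s + mu j) * of_real (lam j))
                  / Gamma (of_real (lam j) * s + mu j)) = (\<Sum>j\<in>{1..r}. of_real (lam j) * Digamma (of_real (lam j) * s + mu j))"
      using nzG by (intro sum.cong refl) (simp add: mult.commute)
    finally show ?thesis by (simp add: gam_def[abs_def])
  qed
  have Ed: "(E has_field_derivative E s * D) (at s)"
  proof -
    have "((\<lambda>s. of_real Q powr s) has_field_derivative of_real (ln Q) * of_real Q powr s) (at s)"
      by (rule derivative_eq_intros refl)+ (use Q in \<open>simp_all add: Ln_of_real\<close>)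
    from DERIV_mult[OF this gd] show ?thesis
      unfolding E_def[abs_def] D_def by (simp add: algebra_simps)
  qed
  have \<Phi>d: "(\<Phi> has_field_derivative deriv F s * E s + E s * D * F s) (at s)"
    unfolding \<Phi>_def by (rule DERIV_mult[OF Fd Ed])
  define \<Phi>' where "\<Phi>' = deriv F s * E s + E s * D * F s"
  have "((\<lambda>u. \<Phi> (1 - u)) has_field_derivative - \<Phi>') (at (cnj s))"
  proof -
    have "(\<Phi> has_field_derivative \<Phi>') (at (1 - cnj s))" using \<Phi>d s(1) \<Phi>'_def by simp
    then have "((\<lambda>u. \<Phi> (1 - u)) has_field_derivative \<Phi>' * (- 1)) (at (cnj s))"
      by (rule DERIV_chain2) (auto intro!: derivative_eq_intros)
    then show ?thesis by simp
  qed
  then have "(cnj \<circ> (\<lambda>u. \<Phi> (1 - u)) \<circ> cnj has_field_derivative cnj (- \<Phi>')) (at s)"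
    by (rule has_field_derivative_cnj_cnj)
  then have "((\<lambda>w. \<omega> * cnj (\<Phi> (1 - cnj w))) has_field_derivative \<omega> * cnj (- \<Phi>')) (at s)"
    unfolding o_def by (rule DERIV_cmult)
  moreover have "\<forall>\<^sub>F w in nhds s. \<omega> * cnj (\<Phi> (1 - cnj w)) = \<Phi> w"
    using eventually_nhds_in_open[OF open_halfspace_Im_gt[of T1], of s] s t
    by (auto elim!: eventually_mono simp: \<Phi>_def FE[symmetric] simp del: complex_cnj_mult)
  ultimately have "(\<Phi> has_field_derivative \<omega> * cnj (- \<Phi>')) (at s)"
    by (rule DERIV_cong_ev[OF refl _ refl, THEN iffD1, rotated])
  from DERIV_unique[OF \<Phi>d[folded \<Phi>'_def] this] have 1: "\<Phi>' = - (\<omega> * cnj \<Phi>')"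
    unfolding complex_cnj_minus mult_minus_right .
  have 2: "\<Phi> s = \<omega> * cnj (\<Phi> s)" using FE[of s] s t unfolding \<Phi>_def by (simp only: less_imp_le)
  have \<Phi>nz: "\<Phi> s \<noteq> 0" using nz E_nz[of s] s t unfolding \<Phi>_def s_def by auto
  have \<omega>0: "\<omega> \<noteq> 0" using \<omega> by auto
  have "\<Phi>' / \<Phi> s = - (\<omega> * cnj \<Phi>') / (\<omega> * cnj (\<Phi> s))" using arg_cong2[where f = "(/)", OF 1 2] .
  also have "\<dots> = - cnj (\<Phi>' / \<Phi> s)" using \<omega>0 unfolding complex_cnj_divide
    by (metis mult_divide_mult_cancel_left minus_divide_left)
  finally have "Re (\<Phi>' / \<Phi> s) = Re (- cnj (\<Phi>' / \<Phi> s))" by (rule arg_cong)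
  then have "Re (\<Phi>' / \<Phi> s) = 0" by (simp del: complex_cnj_divide)
  moreover have "\<Phi>' / \<Phi> s = deriv F s / F s + D"
    using \<Phi>nz unfolding \<Phi>'_def \<Phi>_def by (simp add: field_simps)
  moreover have "Re D = ln Q + (\<Sum>j\<in>{1..r}. lam j * Re (Digamma (of_real (lam j) * s + mu j)))"
    unfolding D_def by simp
  ultimately show ?thesis unfolding s_def by simp
qed

end

subsection \<open>Uniform bounds in the subclass\<close>

lemma selberg_subclass_holomorphic:
  assumes "F \<in> selberg_subclass \<sigma>\<^sub>1 c B \<epsilon> \<delta> Tbar r lam mu"
  shows "F holomorphic_on - {1}"
proof -
  obtain k G where G: "entire_finite_order G" "\<And>s. s \<noteq> 1 \<Longrightarrow> G s = (s - 1) ^ k * F s"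
    using assms unfolding selberg_subclass_def extended_selberg_class_def by blast
  have "(\<lambda>s. G s / (s - 1) ^ k) holomorphic_on - {1}"
    using G(1) unfolding entire_finite_order_def
    by (intro holomorphic_intros) (auto intro: holomorphic_on_subset)
  then show ?thesis by (rule holomorphic_transform) (simp add: G(2))
qed

text \<open>A poor man's two-constants theorem: in the product of the four functions
  \<open>f (c + \<i>^k w)\<close>, at every point of the circle one factor is evaluated in the left part.\<close>
lemma norm_power4_le_rotation:
  fixes f :: "complex \<Rightarrow> complex"
  assumes f: "f holomorphic_on S" "cball c R \<subseteq> S" "R > 0"
    and M: "\<And>z. z \<in> sphere c R \<Longrightarrow> norm (f z) \<le> M"
    and L: "\<And>z. z \<in> sphere c R \<Longrightarrow> Re z \<le> Re c - R / 2 \<Longrightarrow> norm (f z) \<le> L"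
  shows "norm (f c) ^ 4 \<le> M ^ 3 * L"
proof -
  define g where "g = (\<lambda>w. f (c + w) * f (c - w) * f (c + \<i> * w) * f (c - \<i> * w))"
  have in_c: "c + u * w \<in> cball c R" if "norm u = 1" "w \<in> cball 0 R" for u w
    using that by (simp add: dist_norm norm_mult)
  have hol: "(\<lambda>w. f (c + u * w)) holomorphic_on cball 0 R" if "norm u = 1" for u
    by (rule holomorphic_on_compose_gen[OF _ holomorphic_on_subset[OF f(1,2)], unfolded o_def])
      (use in_c that in \<open>auto intro!: holomorphic_intros\<close>)
  have gh: "g holomorphic_on cball 0 R"
    using hol[of 1] hol[of "-1"] hol[of \<i>] hol[of "-\<i>"] unfolding g_def
    by (auto intro!: holomorphic_intros)
  have "norm (g 0) \<le> M ^ 3 * L"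
  proof (rule maximum_modulus_frontier[of g "cball 0 R"])
    show "g holomorphic_on interior (cball 0 R)"
      using gh interior_subset holomorphic_on_subset by blast
    show "continuous_on (closure (cball 0 R)) g"
      using gh by (simp add: holomorphic_on_imp_continuous_on)
    fix w :: complex assume "w \<in> frontier (cball 0 R)"
    then have w: "norm w = R" using f(3) by simp
    define z1 z2 z3 z4 where z: "z1 = c + w" "z2 = c - w" "z3 = c + \<i> * w" "z4 = c - \<i> * w"
    have S: "z1 \<in> sphere c R" "z2 \<in> sphere c R" "z3 \<in> sphere c R" "z4 \<in> sphere c R"
      using w by (auto simp: z dist_norm norm_mult)
    have M0: "0 \<le> M" using M[OF S(1)] norm_ge_zero order_trans by blast
    \<comment> \<open>One of \<open>|Re w|\<close>, \<open>|Im w|\<close> is at least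
      \<open>R / 2\<close>, and the rotations by powers of \<open>\<i>\<close> turn either
      coordinate, with either sign, into the horizontal displacement.\<close>
    have "norm w \<le> \<bar>Re w\<bar> + \<bar>Im w\<bar>" by (rule cmod_le)
    then have "Re z1 \<le> Re c - R / 2 \<or> Re z2 \<le> Re c - R / 2 \<or> Re z3 \<le> Re c - R / 2 \<or> Re z4 \<le> Re c - R / 2"
      unfolding z w by (simp; linarith)
    then have "norm (f z1) \<le> L \<or> norm (f z2) \<le> L \<or> norm (f z3) \<le> L \<or> norm (f z4) \<le> L"
      using L S by blast
    then have "norm (f z1) * norm (f z2) * norm (f z3) * norm (f z4) \<le> M ^ 3 * L"
    proof (elim disjE)
      have *: "a * (b * (d * e)) \<le> M ^ 3 * L" 
        if "a \<le> L" "b \<le> M" "d \<le> M" "e \<le> M" "a \<ge> 0" "b \<ge> 0" "d \<ge> 0" "e \<ge> 0" for a b d e :: real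
      proof -
        have "a * (b * (d * e)) \<le> L * (M * (M * M))" using that M0 by (intro mult_mono) auto
        then show ?thesis by (simp add: power3_eq_cube mult_ac)
      qed
      note n = norm_ge_zero
      { assume "norm (f z1) \<le> L" from *[OF this M[OF S(2)] M[OF S(3)] M[OF S(4)] n n n n] show ?thesis by (simp add: mult_ac) }
      { assume "norm (f z2) \<le> L" from *[OF this M[OF S(1)] M[OF S(3)] M[OF S(4)] n n n n] show ?thesis by (simp add: mult_ac) }
      { assume "norm (f z3) \<le> L" from *[OF this M[OF S(1)] M[OF S(2)] M[OF S(4)] n n n n] show ?thesis by (simp add: mult_ac) }
      { assume "norm (f z4) \<le> L" from *[OF this M[OF S(1)] M[OF S(2)] M[OF S(3)] n n n n] show ?thesis by (simp add: mult_ac) }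
    qed
    then show "norm (g w) \<le> M ^ 3 * L" by (simp add: g_def norm_mult z)
  qed (use f(3) in auto)
  then show ?thesis by (simp add: g_def norm_mult numeral_eq_Suc mult_ac)
qed

locale subclass_data = gamma_data r lam mu T1
  for r lam mu T1 +
  fixes \<sigma>\<^sub>1 c B \<epsilon> \<delta> Tbar :: real
  assumes params: "\<sigma>\<^sub>1 > 1" "c > 0" "B > 0" "\<epsilon> > 0" "\<delta> > 0" "Tbar > 0"
begin

abbreviation "Sbar \<equiv> selberg_subclass \<sigma>\<^sub>1 c B \<epsilon> \<delta> Tbar r lam mu"

lemma Sbar_bound: "F \<in> Sbar \<Longrightarrow> Im s > 10 \<Longrightarrow> Re s \<ge> - 4 * \<sigma>\<^sub>1 \<Longrightarrow> norm (F s) < Im s powr B"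
  unfolding selberg_subclass_def by (metis (mono_tags, lifting) mem_Collect_eq complex_surj)

lemma Sbar_lower: "F \<in> Sbar \<Longrightarrow> norm (F (Complex \<sigma>\<^sub>1 t)) \<ge> c"
  unfolding selberg_subclass_def by blast

lemma Sbar_completed: 
  assumes "F \<in> Sbar" obtains Q \<omega> where "completed_fn r lam mu T1 F Q \<omega>"
proof -
  obtain Q \<omega> where "Q > 0" "norm \<omega> = 1" "functional_equation F r lam mu Q \<omega>"
    using assms unfolding selberg_subclass_def by blast
  then have "completed_fn r lam mu T1 F Q \<omega>"
    using selberg_subclass_holomorphic[OF assms] by unfold_locales auto
  then show ?thesis by (rule that)
qed

text \<open>If \<open>Q\<close> were tiny, the functional equation would make \<open>F\<close> tiny on the left part of a circle
  around \<open>\<sigma>\<^sub>1 + i T\<close>, contradicting the lower bound for \<open>F\<close> at its centre.\<close>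
lemma conductor_lower_bound:
  obtains Q0 where "Q0 > 0" "\<And>F Q \<omega>. F \<in> Sbar \<Longrightarrow> completed_fn r lam mu T1 F Q \<omega> \<Longrightarrow> Q0 \<le> Q"
proof -
  \<comment> \<open>This height keeps the whole disc \<open>K\<close> above \<open>T1\<close>. The
    radius \<open>4 * \<sigma>\<^sub>1\<close> puts the left part of the circle at
    \<open>Re s \<le> - \<sigma>\<^sub>1\<close>, where \<open>Q powr (1 - 2 * Re s) \<le> Q\<close>
    for \<open>Q < 1\<close>.\<close>
  define T where "T = T1 + 4 * \<sigma>\<^sub>1"
  define c0 where "c0 = Complex \<sigma>\<^sub>1 T"
  define M where "M = (T + 4 * \<sigma>\<^sub>1) powr B"
  define ratio where "ratio = (\<lambda>s. norm (gam (1 - cnj s)) / norm (gam s))"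
  define K where "K = cball c0 (4 * \<sigma>\<^sub>1)"
  have K: "T1 \<le> Im s" "Im s \<le> T + 4 * \<sigma>\<^sub>1" "Re s \<ge> -3 * \<sigma>\<^sub>1" if "s \<in> K" for s
  proof -
    have "norm (c0 - s) \<le> 4 * \<sigma>\<^sub>1" using that by (simp add: K_def dist_norm)
    then have "\<bar>Re (c0 - s)\<bar> \<le> 4 * \<sigma>\<^sub>1" "\<bar>Im (c0 - s)\<bar> \<le> 4 * \<sigma>\<^sub>1"
      using abs_Re_le_cmod abs_Im_le_cmod order_trans by blast+
    then show "T1 \<le> Im s" "Im s \<le> T + 4 * \<sigma>\<^sub>1" "Re s \<ge> -3 * \<sigma>\<^sub>1"
      by (auto simp: c0_def T_def abs_le_iff)
  qed
  have contg: "continuous_on {s. Im s \<ge> T1} gam" using gam_holo by (rule holomorphic_on_imp_continuous_on)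
  have "continuous_on K ratio"
  proof -
    have "continuous_on K (\<lambda>s. gam (1 - cnj s))"
      by (rule continuous_on_compose2[OF contg]) (use K in \<open>auto intro!: continuous_intros\<close>)
    moreover have "continuous_on K gam" by (rule continuous_on_subset[OF contg]) (use K in auto)
    ultimately show ?thesis unfolding ratio_def using gam_nz K by (intro continuous_intros) auto
  qed
  then have "compact (ratio ` K)" by (intro compact_continuous_image) (simp_all add: K_def)
  then have "bounded (ratio ` K)" by (rule compact_imp_bounded)
  then obtain C where C: "C > 0" "\<And>s. s \<in> K \<Longrightarrow> ratio s \<le> C"
    unfolding bounded_pos by force
  have M0: "M > 0" using params T1 unfolding M_def T_def by simp
  show ?thesis
  proof (rule that)
    \<comment> \<open>Obtained by solving \<open>c ^ 4 \<le> M ^ 3 * (M * C * Q)\<close> for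
      \<open>Q\<close>; \<open>M\<close> and \<open>C\<close> do not involve \<open>F\<close>, since
      \<open>ratio\<close> consists of Gamma factors only.\<close>
    define Q0 where "Q0 = min 1 (c ^ 4 / (M ^ 4 * C))"
    show "Q0 > 0" using params M0 C by (simp add: Q0_def)
    fix F Q \<omega> assume F: "F \<in> Sbar" and "completed_fn r lam mu T1 F Q \<omega>"
    interpret completed_fn r lam mu T1 F Q \<omega> by fact
    show "Q0 \<le> Q"
    proof (cases "Q \<ge> 1")
      case False
      have MF: "norm (F s) \<le> M" if "Im s \<ge> T1" "Im s \<le> T + 4 * \<sigma>\<^sub>1" "Re s \<ge> -3 * \<sigma>\<^sub>1" for s
      proof -
        have "norm (F s) < Im s powr B" using that T1 params by (intro Sbar_bound[OF F]) auto
        also have "\<dots> \<le> M" unfolding M_def using that T1 params by (intro powr_mono2) auto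
        finally show ?thesis by simp
      qed
      have "norm (F c0) ^ 4 \<le> M ^ 3 * (M * C * Q)"
      proof (rule norm_power4_le_rotation[OF F_holo])
        have "1 \<notin> K" using K(1)[of 1] T1 by auto
        then show "cball c0 (4 * \<sigma>\<^sub>1) \<subseteq> - {1}" unfolding K_def by auto
        show "4 * \<sigma>\<^sub>1 > 0" using params by simp
        fix s assume "s \<in> sphere c0 (4 * \<sigma>\<^sub>1)"
        then have s: "s \<in> K" by (auto simp: K_def)
        show "norm (F s) \<le> M" using MF K[OF s] by blast
        assume "Re s \<le> Re c0 - 4 * \<sigma>\<^sub>1 / 2"
        then have Res: "Re s \<le> - \<sigma>\<^sub>1" by (simp add: c0_def)
        define s' where "s' = 1 - cnj s"
        have s': "Im s' = Im s" "Re s' = 1 - Re s" by (auto simp: s'_def)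
        have nE: "norm (E u) = Q powr Re u * norm (gam u)" for u
          using Q by (simp add: E_def norm_mult norm_powr_real_powr)
        have "norm (F s) * norm (E s) = norm (F s') * norm (E s')"
          using FE[OF K(1)[OF s]] \<omega> unfolding s'_def by (metis complex_mod_cnj mult_1 norm_mult)
        then have "norm (F s) * (Q powr Re s * norm (gam s)) = norm (F s') * (Q powr (1 - Re s) * norm (gam s'))"
          by (simp add: nE s')
        moreover have "Q powr (1 - Re s) = Q powr (1 - 2 * Re s) * Q powr Re s"
          by (simp flip: powr_add)
        ultimately have "norm (F s) = norm (F s') * ratio s * Q powr (1 - 2 * Re s)"
          using gam_nz[OF K(1)[OF s]] Q unfolding ratio_def s'_def by (simp add: field_simps)
        also have "\<dots> \<le> M * C * Q powr 1"
        proof (intro mult_mono)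
          show "norm (F s') \<le> M" using K[OF s] Res params by (intro MF) (auto simp: s')
          show "ratio s \<le> C" by (rule C(2)[OF s])
          show "Q powr (1 - 2 * Re s) \<le> Q powr 1"
            using Q False Res params by (intro powr_mono') auto
        qed (use M0 C in \<open>auto simp: ratio_def\<close>)
        finally show "norm (F s) \<le> M * C * Q" using Q by simp
      qed
      moreover have "c ^ 4 \<le> norm (F c0) ^ 4" unfolding c0_def
        using Sbar_lower[OF F] params by (intro power_mono) auto
      ultimately have "c ^ 4 \<le> M ^ 4 * C * Q" by (simp add: power4_eq_xxxx power3_eq_cube mult_ac)
      then have "c ^ 4 / (M ^ 4 * C) \<le> Q" using M0 C by (simp add: field_simps)
      then show ?thesis by (simp add: Q0_def)
    qed (simp add: Q0_def)
  qed
qed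

lemma Re_logderiv_on_line_le:
  assumes "(\<Sum>j\<in>{1..r}. lam j) > 0"
  obtains T2 where "T2 > T1" 
    "\<And>F t. F \<in> Sbar \<Longrightarrow> t \<ge> T2 \<Longrightarrow> F (Complex (1/2) t) \<noteq> 0 \<Longrightarrow>
        Re (deriv F (Complex (1/2) t) / F (Complex (1/2) t)) \<le> - 1"
proof -
  obtain Q0 where Q0: "Q0 > 0" "\<And>F Q \<omega>. F \<in> Sbar \<Longrightarrow> completed_fn r lam mu T1 F Q \<omega> \<Longrightarrow> Q0 \<le> Q"
    using conductor_lower_bound by blast
  define \<Lambda> where "\<Lambda> = (\<Sum>j\<in>{1..r}. lam j)"
  \<comment> \<open>\<open>b\<close> solves \<open>ln Q0 + \<Lambda> * b = 1\<close>, which is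
    possible because the degree is positive. The 3 in the choice of \<open>N\<close> is the loss in
    \<open>Re_Digamma_ge\<close>.\<close>
  define b where "b = (1 - ln Q0) / \<Lambda>"
  define N where "N = Suc (nat \<lceil>exp (b + 3)\<rceil>)"
  have N: "N > 0" "exp (b + 3) \<le> real N + 1" unfolding N_def by linarith+
  then have Nb: "ln (real N + 1) - 3 \<ge> b"
    using ln_mono[of "exp (b + 3)" "real N + 1"] by simp
  \<comment> \<open>At height \<open>T1\<close> the Gamma arguments already have positive imaginary
    part; a further \<open>N / lam j\<close> raises it by \<open>N\<close>. The sum serves all
    \<open>j\<close> at once.\<close>
  define T2 where "T2 = T1 + 1 + real N * (\<Sum>j\<in>{1..r}. 1 / lam j)"
  have sum0: "(\<Sum>j\<in>{1..r}. 1 / lam j) \<ge> 0" using lam_pos by (intro sum_nonneg) (auto simp: less_imp_le)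
  show ?thesis
  proof (rule that)
    show T21: "T2 > T1" unfolding T2_def using sum0 by (simp add: add_pos_nonneg)
    fix F t assume F: "F \<in> Sbar" and t: "t \<ge> T2" and nz: "F (Complex (1/2) t) \<noteq> 0"
    obtain Q \<omega> where "completed_fn r lam mu T1 F Q \<omega>" using Sbar_completed[OF F] .
    then interpret completed_fn r lam mu T1 F Q \<omega> .
    have "Q0 \<le> Q" using Q0(2)[OF F] completed_fn_axioms .
    then have lnQ: "ln Q0 \<le> ln Q" using Q0 by (simp add: ln_mono)
    have "\<Lambda> * b \<le> (\<Sum>j\<in>{1..r}. lam j * Re (Digamma (of_real (lam j) * Complex (1/2) t + mu j)))"
      unfolding \<Lambda>_def sum_distrib_right
    proof (intro sum_mono mult_left_mono)
      fix j assume j: "j \<in> {1..r}"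
      show "lam j \<ge> 0" using lam_pos[OF j] by simp
      define z where "z = of_real (lam j) * Complex (1/2) t + mu j"
      have "Re z > 0" using lam_pos[OF j] mu_pos[OF j] by (simp add: z_def)
      moreover have "real N \<le> Im z"
      proof -
        have "1 / lam j \<le> (\<Sum>j\<in>{1..r}. 1 / lam j)"
          using j lam_pos by (intro member_le_sum) (auto simp: less_imp_le)
        then have "real N * (1 / lam j) \<le> real N * (\<Sum>j\<in>{1..r}. 1 / lam j)"
          by (intro mult_left_mono) auto
        then have "T1 + real N / lam j \<le> t" using t by (simp add: T2_def)
        then have "lam j * (T1 + real N / lam j) \<le> lam j * t" using lam_pos[OF j] by simp
        moreover have "lam j * T1 + Im (mu j) > 0" using Im_arg_pos[OF j, of T1] by simp
        ultimately show ?thesis using lam_pos[OF j] by (simp add: z_def distrib_left)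
      qed
      ultimately have "ln (real N + 1) - 3 \<le> Re (Digamma z)" using N by (intro Re_Digamma_ge)
      then show "b \<le> Re (Digamma z)" using Nb by simp
    qed
    moreover have "\<Lambda> * b = 1 - ln Q0" using assms unfolding b_def \<Lambda>_def by simp
    ultimately show "Re (deriv F (Complex (1/2) t) / F (Complex (1/2) t)) \<le> - 1"
      using Re_logderiv_on_line[OF _ nz] lnQ t T21 by simp
  qed
qed

end

subsection \<open>The sign of Re (F'/F) to the left of the critical line\<close>

text \<open>With \<open>x = Re s - 1/2\<close>, \<open>u = Re \<rho> - 1/2\<close> and
  \<open>y = Im s - Im \<rho>\<close> this is the real part of
  \<open>1 / (s - \<rho>) + 1 / (s - (1 - cnj \<rho>))\<close>. It equals
  \<open>2x (x^2 + y^2 - u^2)\<close> over a positive denominator, and the second hypothesis keeps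
  \<open>s\<close> out of the open disc having \<open>\<rho>\<close> and its mirror image as ends of
  a diameter.\<close>

lemma Re_inverse_pair_nonpos:
  fixes x u y :: real
  assumes "x \<le> 0" "u\<^sup>2 \<le> x\<^sup>2 + y\<^sup>2"
  shows "(x - u) / ((x - u)\<^sup>2 + y\<^sup>2) + (x + u) / ((x + u)\<^sup>2 + y\<^sup>2) \<le> 0"
proof (cases "(x - u)\<^sup>2 + y\<^sup>2 = 0 \<or> (x + u)\<^sup>2 + y\<^sup>2 = 0")
  case True
  then show ?thesis
  proof
    assume "(x - u)\<^sup>2 + y\<^sup>2 = 0"
    then have "u = x" "y = 0" by (auto simp: sum_power2_eq_zero_iff)
    then show ?thesis using assms by (simp add: divide_le_0_iff)
  next
    assume "(x + u)\<^sup>2 + y\<^sup>2 = 0"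
    then have "u = - x" "y = 0" by (auto simp: sum_power2_eq_zero_iff)
    then show ?thesis using assms by (simp add: divide_le_0_iff)
  qed
next
  case False
  then have p: "(x - u)\<^sup>2 + y\<^sup>2 > 0" "(x + u)\<^sup>2 + y\<^sup>2 > 0"
    by (auto simp: sum_power2_gt_zero_iff)
  have "(x - u) / ((x - u)\<^sup>2 + y\<^sup>2) + (x + u) / ((x + u)\<^sup>2 + y\<^sup>2) =
      2 * x * (x\<^sup>2 + y\<^sup>2 - u\<^sup>2) / (((x - u)\<^sup>2 + y\<^sup>2) * ((x + u)\<^sup>2 + y\<^sup>2))"
    using p by (subst add_frac_eq) (auto simp: power2_eq_square algebra_simps)
  also have "\<dots> \<le> 0" using p assms
    by (intro divide_nonpos_pos mult_pos_pos mult_nonpos_nonneg[of "2 * x"]) auto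
  finally show ?thesis .
qed

lemma Re_nat_divide: "Re (of_nat n / z) = real n * (Re z / ((Re z)\<^sup>2 + (Im z)\<^sup>2))"
  by (simp add: Re_divide)

text \<open>No zero off the critical line lies in the annulus \<open>a < |s - s1| < b\<close>; zeros on the line are
  harmless, since their contribution to \<open>Re (F'/F)\<close> is nonpositive on the left.\<close>
locale annulus_data =
  fixes F :: "complex \<Rightarrow> complex" and T :: real and s1 :: complex and Z :: "complex set"
    and n :: "complex \<Rightarrow> nat" and q :: "complex \<Rightarrow> complex" and a b Nb Kq :: real
  assumes s1: "s1 = Complex (1/2) T"
    and F_holo: "F holomorphic_on ball s1 (1/2)"
    and Z: "finite Z" "\<And>z. z \<in> ball s1 (1/2) \<Longrightarrow> F z = 0 \<Longrightarrow> z \<in> Z"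
    and q_holo: "q holomorphic_on ball s1 (1/2)"
    and Kq: "\<And>z. z \<in> ball s1 (1/2) \<Longrightarrow> norm (deriv q z) \<le> Kq"
    and Nb: "real (sum n Z) \<le> Nb"
    and logderiv: "\<And>z. z \<in> ball s1 (1/2) \<Longrightarrow> F z \<noteq> 0 \<Longrightarrow>
        deriv F z / F z = (\<Sum>\<rho>\<in>Z. of_nat (n \<rho>) / (z - \<rho>)) + q z"
    and sym: "\<And>z. z \<in> Z \<Longrightarrow> dist s1 z \<le> a \<Longrightarrow> 1 - cnj z \<in> Z \<and> n (1 - cnj z) = n z"
    and gap: "\<And>z. z \<in> Z \<Longrightarrow> Re z \<noteq> 1/2 \<Longrightarrow> dist s1 z \<le> a \<or> dist s1 z \<ge> b"
    and line: "\<And>t. \<bar>t - T\<bar> < 1/2 \<Longrightarrow> F (Complex (1/2) t) \<noteq> 0 \<Longrightarrow>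
        Re (deriv F (Complex (1/2) t) / F (Complex (1/2) t)) \<le> - 1"
    and a: "a > 0" "20 * a < b" "b \<le> 1/2"
    and small: "10 * a * (4 * Nb / b\<^sup>2 + Kq) < 1"
begin

abbreviation "U \<equiv> ball s1 (1/2)"

definition "Zon = {\<rho>\<in>Z. Re \<rho> = 1/2}"
definition "Zin = {\<rho>\<in>Z. Re \<rho> \<noteq> 1/2 \<and> dist s1 \<rho> \<le> a}"
definition "Zout = {\<rho>\<in>Z. Re \<rho> \<noteq> 1/2 \<and> dist s1 \<rho> > a}"

text \<open>Unlike \<open>F' / F\<close>, the sum \<open>V + G\<close> has no pole on the critical
  line, since the zeros in \<open>Zon\<close> are left out. It can therefore be evaluated at every
  height.\<close>

definition "V s = (\<Sum>\<rho>\<in>Zin. of_nat (n \<rho>) / (s - \<rho>))"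
definition "G s = (\<Sum>\<rho>\<in>Zout. of_nat (n \<rho>) / (s - \<rho>)) + q s"

lemma fin: "finite Zon" "finite Zin" "finite Zout"
  using Z(1) by (auto simp: Zon_def Zin_def Zout_def)

lemma in_U: "s \<in> U" if "dist s1 s \<le> 10 * a" for s using that a by simp

lemma logderiv_split:
  assumes "z \<in> U" "F z \<noteq> 0"
  shows "deriv F z / F z = (\<Sum>\<rho>\<in>Zon. of_nat (n \<rho>) / (z - \<rho>)) + (V z + G z)"
proof -
  have "Z = Zon \<union> Zin \<union> Zout" by (auto simp: Zon_def Zin_def Zout_def)
  then have "(\<Sum>\<rho>\<in>Z. of_nat (n \<rho>) / (z - \<rho>)) = (\<Sum>\<rho>\<in>Zon \<union> Zin \<union> Zout. of_nat (n \<rho>) / (z - \<rho>))" by simp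
  also have "\<dots> = (\<Sum>\<rho>\<in>Zon. of_nat (n \<rho>) / (z - \<rho>)) + V z + (\<Sum>\<rho>\<in>Zout. of_nat (n \<rho>) / (z - \<rho>))"
    unfolding V_def using fin
    by (subst sum.union_disjoint, (auto simp: Zon_def Zin_def Zout_def)[3])+ simp
  finally show ?thesis using logderiv[OF assms] by (simp add: G_def)
qed

lemma Re_on_sum: 
  "Re s \<le> 1/2 \<Longrightarrow> Re (\<Sum>\<rho>\<in>Zon. of_nat (n \<rho>) / (s - \<rho>)) \<le> 0"
  "Re s = 1/2 \<Longrightarrow> Re (\<Sum>\<rho>\<in>Zon. of_nat (n \<rho>) / (s - \<rho>)) = 0"
  unfolding Re_sum Re_nat_divide
  by (auto simp: Zon_def intro!: sum_nonpos mult_nonneg_nonpos divide_nonpos_nonneg sum.neutral)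

lemma Re_logderiv_le: "z \<in> U \<Longrightarrow> F z \<noteq> 0 \<Longrightarrow> Re z \<le> 1/2 \<Longrightarrow> Re (deriv F z / F z) \<le> Re (V z + G z)"
  unfolding logderiv_split plus_complex.sel(1)[of "sum _ Zon"] using Re_on_sum(1)[of z] by simp

lemma reflect_Zin: "bij_betw (\<lambda>\<rho>. 1 - cnj \<rho>) Zin Zin" "\<rho> \<in> Zin \<Longrightarrow> n (1 - cnj \<rho>) = n \<rho>"
proof -
  have d: "dist s1 (1 - cnj \<rho>) = dist s1 \<rho>" for \<rho>
    by (simp add: s1 dist_norm cmod_def power2_eq_square algebra_simps)
  have m: "1 - cnj \<rho> \<in> Zin" if "\<rho> \<in> Zin" for \<rho>
    using that sym[of \<rho>] d by (auto simp: Zin_def)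
  show "bij_betw (\<lambda>\<rho>. 1 - cnj \<rho>) Zin Zin"
    by (rule bij_betwI[where g = "\<lambda>\<rho>. 1 - cnj \<rho>"]) (auto intro: m)
  show "\<rho> \<in> Zin \<Longrightarrow> n (1 - cnj \<rho>) = n \<rho>" using sym[of \<rho>] by (auto simp: Zin_def)
qed

text \<open>\<open>V\<close> is averaged with its own reindexing by \<open>\<rho>\<close> to
  \<open>1 - cnj \<rho>\<close>, which permutes \<open>Zin\<close> and preserves multiplicities. The
  summands then have the shape of \<open>Re_inverse_pair_nonpos\<close>.\<close>

lemma two_Re_V:
  "2 * Re (V s) = (\<Sum>\<rho>\<in>Zin. real (n \<rho>) * ((Re s - 1/2 - (Re \<rho> - 1/2)) / ((Re s - 1/2 - (Re \<rho> - 1/2))\<^sup>2 + (Im s - Im \<rho>)\<^sup>2)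
      + (Re s - 1/2 + (Re \<rho> - 1/2)) / ((Re s - 1/2 + (Re \<rho> - 1/2))\<^sup>2 + (Im s - Im \<rho>)\<^sup>2)))"
proof -
  have "V s = (\<Sum>\<rho>\<in>Zin. of_nat (n (1 - cnj \<rho>)) / (s - (1 - cnj \<rho>)))"
    unfolding V_def using sum.reindex_bij_betw[OF reflect_Zin(1), of "\<lambda>\<rho>. of_nat (n \<rho>) / (s - \<rho>)"] by simp
  also have "\<dots> = (\<Sum>\<rho>\<in>Zin. of_nat (n \<rho>) / (s - (1 - cnj \<rho>)))"
    using reflect_Zin(2) by (intro sum.cong) auto
  finally have 1: "Re (V s) = (\<Sum>\<rho>\<in>Zin. Re (of_nat (n \<rho>) / (s - (1 - cnj \<rho>))))" by simp
  have 2: "Re (V s) = (\<Sum>\<rho>\<in>Zin. Re (of_nat (n \<rho>) / (s - \<rho>)))" by (simp add: V_def)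
  have "2 * Re (V s) = (\<Sum>\<rho>\<in>Zin. Re (of_nat (n \<rho>) / (s - \<rho>)) + Re (of_nat (n \<rho>) / (s - (1 - cnj \<rho>))))"
    unfolding sum.distrib using 1 2 by simp
  then show ?thesis unfolding Re_nat_divide by (simp add: algebra_simps)
qed

lemma Re_V_on_line: "Re s = 1/2 \<Longrightarrow> Re (V s) = 0"
proof -
  assume "Re s = 1/2"
  then have x: "Re s - 1/2 = 0" by simp
  have *: "k * ((0 - u) / ((0 - u)\<^sup>2 + y) + (0 + u) / ((0 + u)\<^sup>2 + y)) = 0" for k u y :: real
    by simp
  have "2 * Re (V s) = 0" unfolding two_Re_V x
  proof (intro sum.neutral ballI)
    show "real (n \<rho>) * ((0 - (Re \<rho> - 1/2)) / ((0 - (Re \<rho> - 1/2))\<^sup>2 + (Im s - Im \<rho>)\<^sup>2)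
      + (0 + (Re \<rho> - 1/2)) / ((0 + (Re \<rho> - 1/2))\<^sup>2 + (Im s - Im \<rho>)\<^sup>2)) = 0" for \<rho>
      by (simp only: *)
  qed
  then show ?thesis by simp
qed

text \<open>A zero of \<open>Zin\<close> and its mirror image have a midpoint on the line within
  \<open>a\<close> of \<open>s1\<close>, and both lie within \<open>a\<close> of that midpoint. A
  point further than \<open>2a\<close> from \<open>s1\<close> is thus outside every disc spanned by
  such a pair.\<close>

lemma Re_V_nonpos:
  assumes "Re s \<le> 1/2" "2 * a < dist s1 s" shows "Re (V s) \<le> 0"
proof -
  have "2 * Re (V s) \<le> 0" unfolding two_Re_V
  proof (intro sum_nonpos mult_nonneg_nonpos Re_inverse_pair_nonpos)
    fix \<rho> assume "\<rho> \<in> Zin"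
    then have d: "dist s1 \<rho> \<le> a" by (simp add: Zin_def)
    have "\<bar>Re (s1 - \<rho>)\<bar> \<le> a" "\<bar>Im (s1 - \<rho>)\<bar> \<le> a"
      using d abs_Re_le_cmod abs_Im_le_cmod order_trans unfolding dist_norm by blast+
    then have R: "\<bar>Re \<rho> - 1/2\<bar> \<le> a" and I: "\<bar>T - Im \<rho>\<bar> \<le> a" by (auto simp: s1)
    define m where "m = Complex (1/2) (Im \<rho>)"
    have "dist s1 m \<le> a" using I by (simp add: s1 m_def dist_norm cmod_def)
    then have "dist s m \<ge> a" using assms(2) dist_triangle[of s1 s m] dist_commute[of m s] by linarith
    then have "a\<^sup>2 \<le> (dist s m)\<^sup>2" using a by (intro power_mono) auto
    also have "(dist s m)\<^sup>2 = (Re s - 1/2)\<^sup>2 + (Im s - Im \<rho>)\<^sup>2"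
      by (simp add: dist_norm cmod_power2 m_def)
    finally show "(Re \<rho> - 1/2)\<^sup>2 \<le> (Re s - 1/2)\<^sup>2 + (Im s - Im \<rho>)\<^sup>2"
      using power_mono[OF R, of 2] by simp
  qed (use assms in auto)
  then show ?thesis by simp
qed

lemma isCont_VG: "s \<in> U \<Longrightarrow> s \<notin> Zin \<union> Zout \<Longrightarrow> isCont (\<lambda>s. V s + G s) s"
  unfolding V_def G_def
  using holomorphic_on_imp_continuous_on[OF q_holo] 
  by (intro continuous_intros) (auto simp: continuous_on_eq_continuous_at)

lemma line_not_off: "Re s = 1/2 \<Longrightarrow> s \<notin> Zin \<union> Zout" by (auto simp: Zin_def Zout_def)

text \<open>Where \<open>F\<close> does not vanish, the terms of \<open>Zon\<close> are purely
  imaginary on the line, so the bound for \<open>F' / F\<close> passes to \<open>V + G\<close>. The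
  remaining heights are isolated and follow by continuity.\<close>

lemma Re_VG_on_line:
  assumes "\<bar>t - T\<bar> < 1/2" shows "Re (V (Complex (1/2) t) + G (Complex (1/2) t)) \<le> - 1"
proof -
  define p where "p = (\<lambda>t. Complex (1/2) t)"
  have pU: "p t \<in> U" if "\<bar>t - T\<bar> < 1/2" for t
    using that by (simp add: s1 p_def dist_norm cmod_def abs_minus_commute)
  have contp: "isCont p t" unfolding p_def Complex_eq by (intro continuous_intros)
  have "((\<lambda>t. Re (V (p t) + G (p t))) \<longlongrightarrow> Re (V (p t) + G (p t))) (at t)"
  proof -
    have "isCont (\<lambda>s. V s + G s) (p t)"
      by (rule isCont_VG[OF pU[OF assms] line_not_off]) (simp add: p_def)
    from isCont_o2[OF contp this] show ?thesis unfolding isCont_def by (rule tendsto_Re)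
  qed
  moreover have "\<forall>\<^sub>F t' in at t. Re (V (p t') + G (p t')) \<le> - 1"
  proof -
    have "finite (Im ` Z - {t})" using Z(1) by simp
    then have "open (- (Im ` Z - {t}) \<inter> {T - 1/2<..<T + 1/2})" 
      by (intro open_Int open_Compl finite_imp_closed) auto
    moreover have "t \<in> - (Im ` Z - {t}) \<inter> {T - 1/2<..<T + 1/2}" using assms[unfolded abs_less_iff] by auto
    ultimately have "\<forall>\<^sub>F t' in at t. t' \<in> - (Im ` Z - {t}) \<inter> {T - 1/2<..<T + 1/2} \<and> t' \<noteq> t"
      using eventually_nhds_in_open by (force simp: eventually_at_filter elim: eventually_mono)
    then show ?thesis
    proof eventually_elim
      case (elim t')
      then have t': "\<bar>t' - T\<bar> < 1/2" "t' \<notin> Im ` Z" unfolding abs_less_iff by auto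
      have "F (p t') \<noteq> 0" using Z(2)[OF pU[OF t'(1)]] t'(2) by (force simp: p_def image_iff)
      then show ?case using line[OF t'(1)] logderiv_split[OF pU[OF t'(1)]] Re_on_sum(2)[of "p t'"]
        by (simp add: p_def)
    qed
  qed
  ultimately have "Re (V (p t) + G (p t)) \<le> - 1" by (rule tendsto_upperbound) simp
  then show ?thesis by (simp add: p_def)
qed

text \<open>Outer zeros are at least \<open>b\<close> from \<open>s1\<close>, and
  \<open>10a < b / 2\<close>; so they stay \<open>b / 2\<close> away from the disc, and each
  contributes at most \<open>4 / b^2\<close> per multiplicity to \<open>|G'|\<close>.\<close>

lemma G_lipschitz:
  assumes "dist s1 x \<le> 10 * a" "dist s1 y \<le> 10 * a"
  shows "norm (G x - G y) \<le> (4 * Nb / b\<^sup>2 + Kq) * norm (x - y)"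
proof (rule field_differentiable_bound[of "cball s1 (10 * a)"])
  define G' where "G' = (\<lambda>s. (\<Sum>\<rho>\<in>Zout. - of_nat (n \<rho>) / (s - \<rho>)\<^sup>2) + deriv q s)"
  fix s assume "s \<in> cball s1 (10 * a)"
  then have s: "dist s1 s \<le> 10 * a" by simp
  have far: "norm (s - \<rho>) \<ge> b / 2" if "\<rho> \<in> Zout" for \<rho>
  proof -
    have "dist s1 \<rho> \<ge> b" using that gap[of \<rho>] by (auto simp: Zout_def)
    then show ?thesis using s dist_triangle[of s1 \<rho> s] a by (simp add: dist_norm)
  qed
  then have nz: "s - \<rho> \<noteq> 0" if "\<rho> \<in> Zout" for \<rho> using that a by fastforce
  have "(q has_field_derivative deriv q s) (at s)"
    using q_holo in_U[OF s] by (simp add: holomorphic_derivI)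
  then have "(G has_field_derivative G' s) (at s)"
    unfolding G_def[abs_def] G'_def using nz
    by (auto intro!: derivative_eq_intros sum.cong simp: power2_eq_square)
  then show "(G has_field_derivative G' s) (at s within cball s1 (10 * a))"
    by (rule has_field_derivative_at_within)
  have "norm (G' s) \<le> (\<Sum>\<rho>\<in>Zout. norm (- of_nat (n \<rho>) / (s - \<rho>)\<^sup>2)) + norm (deriv q s)"
    unfolding G'_def by (rule order_trans[OF norm_triangle_ineq add_right_mono[OF norm_sum]])
  also have "\<dots> \<le> (\<Sum>\<rho>\<in>Zout. real (n \<rho>) * (4 / b\<^sup>2)) + Kq"
  proof (intro add_mono sum_mono Kq in_U[OF s])
    fix \<rho> assume "\<rho> \<in> Zout"
    then have "(b / 2)\<^sup>2 \<le> norm (s - \<rho>) ^ 2" using far a by (intro power_mono) auto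
    then have "real (n \<rho>) / norm (s - \<rho>) ^ 2 \<le> real (n \<rho>) / (b / 2)\<^sup>2"
      using a by (intro divide_left_mono mult_pos_pos) auto
    then show "norm (- of_nat (n \<rho>) / (s - \<rho>)\<^sup>2) \<le> real (n \<rho>) * (4 / b\<^sup>2)"
      by (simp add: norm_divide norm_power power_divide)
  qed
  also have "(\<Sum>\<rho>\<in>Zout. real (n \<rho>) * (4 / b\<^sup>2)) = real (sum n Zout) * (4 / b\<^sup>2)"
    unfolding of_nat_sum by (rule sum_distrib_right[symmetric])
  also have "\<dots> \<le> Nb * (4 / b\<^sup>2)"
  proof (intro mult_right_mono)
    have "sum n Zout \<le> sum n Z" using Z(1) by (intro sum_mono2) (auto simp: Zout_def)
    then show "real (sum n Zout) \<le> Nb" using Nb by linarith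
  qed simp
  finally show "norm (G' s) \<le> 4 * Nb / b\<^sup>2 + Kq" by (simp add: mult_ac)
qed (use assms in auto)

text \<open>\<open>s\<close> is compared with its horizontal projection \<open>s'\<close> on the
  line. There \<open>Re V\<close> vanishes and \<open>Re G \<le> -1\<close>; by
  \<open>small\<close>, moving back to \<open>s\<close> changes \<open>G\<close> by less than 1, and
  \<open>V\<close> and the terms of \<open>Zon\<close> only help.\<close>

lemma Re_logderiv_neg_annulus:
  assumes "Re s < 1/2" "2 * a < dist s1 s" "dist s1 s \<le> 10 * a"
  shows "F s \<noteq> 0" "Re (deriv F s / F s) < 0"
proof -
  show nz: "F s \<noteq> 0" using Z(2)[OF in_U[OF assms(3)]] gap[of s] assms a by auto
  define s' where "s' = Complex (1/2) (Im s)"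
  have d': "dist s1 s' \<le> 10 * a" "\<bar>Im s - T\<bar> \<le> 10 * a"
  proof -
    have "\<bar>Im (s1 - s)\<bar> \<le> 10 * a" using assms(3) abs_Im_le_cmod order_trans unfolding dist_norm by blast
    then show "dist s1 s' \<le> 10 * a" "\<bar>Im s - T\<bar> \<le> 10 * a"
      by (auto simp: s1 s'_def dist_norm cmod_def abs_minus_commute)
  qed
  have "\<bar>Re (s1 - s)\<bar> \<le> 10 * a" using assms(3) abs_Re_le_cmod order_trans unfolding dist_norm by blast
  then have ss': "norm (s - s') \<le> 10 * a" by (simp add: s1 s'_def cmod_def abs_minus_commute)
  have C: "4 * Nb / b\<^sup>2 + Kq \<ge> 0"
  proof -
    have "Kq \<ge> 0" using Kq[OF in_U[OF assms(3)]] norm_ge_zero order_trans by blast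
    moreover have "Nb \<ge> 0" using Nb by linarith
    ultimately show ?thesis by simp
  qed
  have "Re (G s) - Re (G s') \<le> norm (G s - G s')" using complex_Re_le_cmod[of "G s - G s'"] by simp
  also have "\<dots> \<le> (4 * Nb / b\<^sup>2 + Kq) * norm (s - s')" by (rule G_lipschitz[OF assms(3) d'(1)])
  also have "\<dots> \<le> (4 * Nb / b\<^sup>2 + Kq) * (10 * a)" using C ss' by (intro mult_left_mono)
  also have "\<dots> < 1" using small by (simp add: mult_ac)
  finally have "Re (G s) < Re (G s') + 1" by simp
  moreover have "Re (G s') \<le> - 1"
  proof -
    have "\<bar>Im s - T\<bar> < 1/2" using d'(2) a by simp
    then show ?thesis using Re_VG_on_line[of "Im s"] Re_V_on_line[of s'] by (simp add: s'_def)
  qed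
  moreover have "Re (V s) \<le> 0" using assms by (intro Re_V_nonpos) auto
  ultimately show "Re (deriv F s / F s) < 0"
    using Re_logderiv_le[OF in_U[OF assms(3)] nz] assms(1) by simp
qed

text \<open>The set where \<open>Re (V + G) < 0\<close> is open and contains the compact segment
  \<open>A\<close> of the line. The resulting \<open>e\<close> is not uniform in \<open>F\<close> or
  \<open>T\<close>, which is harmless: it only places the right side of the rectangle.\<close>

lemma Re_logderiv_neg_near_line:
  obtains e where "e > 0"
    "\<And>s. 1/2 - e < Re s \<Longrightarrow> Re s < 1/2 \<Longrightarrow> \<bar>Im s - T\<bar> \<le> 3 * a \<Longrightarrow> F s \<noteq> 0 \<and> Re (deriv F s / F s) < 0"
proof -
  define A where "A = (\<lambda>t. Complex (1/2) t) ` {T - 3 * a..T + 3 * a}"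
  define D where "D = U - (Zin \<union> Zout)"
  define W where "W = {s \<in> D. Re (V s + G s) < 0}"
  have "open D" unfolding D_def using fin by (intro open_Diff finite_imp_closed) auto
  moreover have "continuous_on D (\<lambda>s. Re (V s + G s))"
    using isCont_VG by (intro continuous_on_Re continuous_at_imp_continuous_on) (auto simp: D_def)
  ultimately have "open W" unfolding W_def
    using continuous_on_open_vimage[of D "\<lambda>s. Re (V s + G s)"] 
    by (auto simp: vimage_def Int_def conj_commute dest!: spec[of _ "{..<0}"])
  moreover have "compact A" unfolding A_def Complex_eq
    by (intro compact_continuous_image continuous_intros) auto
  moreover have "A \<subseteq> W"
  proof
    fix s assume "s \<in> A"
    then obtain t where t: "s = Complex (1/2) t" "\<bar>t - T\<bar> \<le> 3 * a" by (auto simp: A_def abs_le_iff)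
    have "s \<in> U" using t a by (simp add: s1 dist_norm cmod_def abs_minus_commute)
    moreover have "Re (V s + G s) \<le> - 1" unfolding t(1) using t(2) a by (intro Re_VG_on_line) auto
    ultimately show "s \<in> W" using line_not_off[of s] t(1) by (auto simp: W_def D_def)
  qed
  ultimately obtain e where e: "e > 0" "(\<Union>x\<in>A. ball x e) \<subseteq> W"
    by (metis compact_subset_open_imp_ball_epsilon_subset)
  show ?thesis
  proof (rule that[OF e(1)])
    fix s assume s: "1/2 - e < Re s" "Re s < 1/2" "\<bar>Im s - T\<bar> \<le> 3 * a"
    have "Complex (1/2) (Im s) \<in> A" using s(3) unfolding A_def by (intro imageI) (auto simp: abs_le_iff)
    moreover have "s \<in> ball (Complex (1/2) (Im s)) e" using s by (simp add: dist_norm cmod_def)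
    ultimately have sW: "s \<in> W" using e(2) by blast
    then have U: "s \<in> U" by (simp add: W_def D_def)
    have nz: "F s \<noteq> 0" using Z(2)[OF U] sW s(2) by (auto simp: W_def D_def Zin_def Zout_def)
    then show "F s \<noteq> 0 \<and> Re (deriv F s / F s) < 0"
      using Re_logderiv_le[OF U nz] s(2) sW by (auto simp: W_def)
  qed
qed

end

subsection \<open>Comparing the zeros of F and F'\<close>

text \<open>The winding number is 1 inside the rectangle and 0 outside, which turns the weighted sum
  of \<open>Rouche_theorem\<close> into a count with multiplicity.\<close>

lemma winding_sum_eq_zero_count:
  fixes f :: "complex \<Rightarrow> complex"
  assumes f: "f holomorphic_on S" "open S" "connected S" "finite {z \<in> S. f z = 0}"
    and box: "cbox a1 a3 \<subseteq> S" "Re a1 \<le> Re a3" "Im a1 \<le> Im a3"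
    and nz: "\<And>p. p \<in> path_image (rectpath a1 a3) \<Longrightarrow> f p \<noteq> 0"
  shows "(\<Sum>p\<in>{z \<in> S. f z = 0}. winding_number (rectpath a1 a3) p * of_int (zorder f p)) =
           of_nat (zero_count f (box a1 a3))"
proof -
  have "a1 \<in> path_image (rectpath a1 a3)" using box by (simp add: path_image_rectpath_cbox_minus_box in_cbox_complex_iff in_box_complex_iff)
  then have "\<exists>w\<in>S. f w \<noteq> 0" using nz path_image_rectpath_subset_cbox[OF box(2,3)] box(1) by blast
  then have ord: "zorder f p > 0" if "p \<in> S" "f p = 0" for p
    using zorder_pos_at_zero[OF f(1-3)] that by blast
  have "(\<Sum>p\<in>{z \<in> S. f z = 0}. winding_number (rectpath a1 a3) p * of_int (zorder f p)) =
     (\<Sum>p\<in>{z \<in> S. f z = 0}. if p \<in> box a1 a3 then of_nat (nat (zorder f p)) else 0)"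
  proof (intro sum.cong refl)
    fix p assume p: "p \<in> {z \<in> S. f z = 0}"
    show "winding_number (rectpath a1 a3) p * of_int (zorder f p) = 
        (if p \<in> box a1 a3 then of_nat (nat (zorder f p)) else 0)"
    proof (cases "p \<in> box a1 a3")
      case True
      then show ?thesis using winding_number_rectpath[OF True] ord[of p] p by simp
    next
      case False
      then have "p \<notin> cbox a1 a3" using p nz[of p] path_image_rectpath_cbox_minus_box[OF box(2,3)] by auto
      then show ?thesis using winding_number_rectpath_outside[OF box(2,3)] False by simp
    qed
  qed
  also have "\<dots> = of_nat (\<Sum>p\<in>{z \<in> S. f z = 0} \<inter> box a1 a3. nat (zorder f p))"
    using f(4) by (simp add: sum.inter_restrict[symmetric])
  also have "{z \<in> S. f z = 0} \<inter> box a1 a3 = zeros_in f (box a1 a3)"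
    using box(1) box_subset_cbox by (auto simp: zeros_in_def)
  finally show ?thesis by (simp add: zero_count_def)
qed

text \<open>\<open>Re (F'/F) < 0\<close> on the contour gives \<open>|F + k F'| < |F|\<close> there for small \<open>k > 0\<close>, so
  Rouche's theorem compares \<open>F\<close> with \<open>- k F'\<close>.\<close>
lemma zero_count_deriv_rectangle:
  fixes F :: "complex \<Rightarrow> complex"
  assumes F: "F holomorphic_on S" "open S" "connected S"
    and fin: "finite {z \<in> S. F z = 0}" "finite {z \<in> S. deriv F z = 0}"
    and box: "cbox a1 a3 \<subseteq> S" "Re a1 \<le> Re a3" "Im a1 \<le> Im a3"
    and neg: "\<And>p. p \<in> path_image (rectpath a1 a3) \<Longrightarrow> F p \<noteq> 0 \<and> Re (deriv F p / F p) < 0"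
  shows "zero_count F (box a1 a3) = zero_count (deriv F) (box a1 a3)"
proof -
  define P where "P = path_image (rectpath a1 a3)"
  define \<phi> where "\<phi> = (\<lambda>p. deriv F p / F p)"
  have PS: "P \<subseteq> S" unfolding P_def using path_image_rectpath_subset_cbox[OF box(2,3)] box(1) by blast
  have F': "deriv F holomorphic_on S" using F by (intro holomorphic_deriv)
  have neg': "Re (\<phi> p) < 0" if "p \<in> P" for p using neg that by (simp add: P_def \<phi>_def)
  have cont: "continuous_on P \<phi>" unfolding \<phi>_def
    using holomorphic_on_imp_continuous_on[OF F(1)] holomorphic_on_imp_continuous_on[OF F'] neg
    by (intro continuous_intros continuous_on_subset[OF _ PS]) (auto simp: P_def)
  obtain k where k: "k > 0" "\<And>p. p \<in> P \<Longrightarrow> k * (norm (\<phi> p))\<^sup>2 < - 2 * Re (\<phi> p)"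
  proof -
    \<comment> \<open>\<open>|1 + k \<phi>| < 1\<close> amounts to
      \<open>k |\<phi>|^2 < - 2 Re \<phi>\<close>. The \<open>+ 1\<close> in the denominator makes
      this strict even for the minimum of \<open>h\<close> over the contour.\<close>
    define h where "h = (\<lambda>p. - 2 * Re (\<phi> p) / ((norm (\<phi> p))\<^sup>2 + 1))"
    have nz: "(norm (\<phi> p))\<^sup>2 + 1 \<noteq> 0" for p by (smt (verit) zero_le_power2)
    have "continuous_on P h" unfolding h_def using nz by (intro continuous_intros cont) auto
    moreover have "compact P" "P \<noteq> {}" unfolding P_def by (auto intro: compact_path_image)
    ultimately obtain m where m: "m \<in> P" "\<And>p. p \<in> P \<Longrightarrow> h m \<le> h p"
      using continuous_attains_inf[of P h] by blast
    show ?thesis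
    proof (rule that)
      show "h m > 0" unfolding h_def using neg'[OF m(1)] by (intro divide_pos_pos) (auto simp: add_nonneg_pos)
      fix p assume p: "p \<in> P"
      have "h m * (norm (\<phi> p))\<^sup>2 \<le> h p * (norm (\<phi> p))\<^sup>2" by (intro mult_right_mono m p) auto
      also have "\<dots> < h p * ((norm (\<phi> p))\<^sup>2 + 1)"
        using neg'[OF p] unfolding h_def by (intro mult_strict_left_mono divide_pos_pos) (auto simp: add_nonneg_pos)
      also have "\<dots> = - 2 * Re (\<phi> p)" using nz[of p] by (simp add: h_def)
      finally show "h m * (norm (\<phi> p))\<^sup>2 < - 2 * Re (\<phi> p)" .
    qed
  qed
  \<comment> \<open>The sign makes \<open>F + g = - k F'\<close>, which has the zeros and orders of
    \<open>F'\<close>.\<close>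
  define g where "g = (\<lambda>p. - (F p + of_real k * deriv F p))"
  have less: "norm (g p) < norm (F p)" if "p \<in> P" for p
  proof -
    have nz: "F p \<noteq> 0" using neg that by (simp add: P_def)
    have "norm (1 + of_real k * \<phi> p) ^ 2 = 1 + k * (2 * Re (\<phi> p) + k * (norm (\<phi> p))\<^sup>2)"
      unfolding cmod_power2 by (simp add: power2_eq_square algebra_simps)
    also have "\<dots> < 1"
    proof -
      have "2 * Re (\<phi> p) + k * (norm (\<phi> p))\<^sup>2 < 0" using k(2)[OF that] by simp
      then show ?thesis using k(1) by (simp add: mult_pos_neg)
    qed
    finally have "norm (1 + of_real k * \<phi> p) < 1" by (simp add: power_less_one_iff abs_square_less_1)
    then have "norm (F p) * norm (1 + of_real k * \<phi> p) < norm (F p) * 1"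
      using nz by (intro mult_strict_left_mono) auto
    moreover have "norm (g p) = norm (F p * (1 + of_real k * \<phi> p))"
      using nz unfolding g_def \<phi>_def norm_minus_cancel by (simp add: distrib_left)
    ultimately show ?thesis by (simp add: norm_mult)
  qed
  define f' where "f' = (\<lambda>p. - of_real k * deriv F p)"
  have sum_eq: "F p + g p = f' p" for p by (simp add: g_def f'_def)
  have zeq: "{z \<in> S. f' z = 0} = {z \<in> S. deriv F z = 0}" using k(1) by (simp add: f'_def)
  have zord: "zorder f' p = zorder (deriv F) p" for p
    unfolding f'_def using k(1) by (intro zorder_cmult) auto
  have nzP: "deriv F p \<noteq> 0" if "p \<in> path_image (rectpath a1 a3)" for p using neg[OF that] by auto
  have "(\<Sum>p\<in>{p \<in> S. F p + g p = 0}. winding_number (rectpath a1 a3) p * zorder (\<lambda>p. F p + g p) p) =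
      (\<Sum>p\<in>{p \<in> S. F p = 0}. winding_number (rectpath a1 a3) p * zorder F p)"
  proof (rule Rouche_theorem)
    show "finite {p \<in> S. F p + g p = 0}" unfolding sum_eq zeq by (rule fin)
    show "g holomorphic_on S" unfolding g_def by (intro holomorphic_intros F(1) F')
    show "\<forall>z\<in>path_image (rectpath a1 a3). cmod (g z) < cmod (F z)" using less by (simp add: P_def)
    show "\<forall>z. z \<notin> S \<longrightarrow> winding_number (rectpath a1 a3) z = 0"
      using winding_number_rectpath_outside[OF box(2,3)] box(1) by blast
  qed (use F fin PS in \<open>auto simp: P_def\<close>)
  then have "(\<Sum>p\<in>{p \<in> S. deriv F p = 0}. winding_number (rectpath a1 a3) p * of_int (zorder (deriv F) p)) =
      (\<Sum>p\<in>{p \<in> S. F p = 0}. winding_number (rectpath a1 a3) p * of_int (zorder F p))"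
    unfolding sum_eq zeq zord by simp
  then have "of_nat (zero_count (deriv F) (box a1 a3)) = (of_nat (zero_count F (box a1 a3)) :: complex)"
    using winding_sum_eq_zero_count[OF F' F(2,3) fin(2) box nzP] 
      winding_sum_eq_zero_count[OF F fin(1) box] neg by simp
  then show ?thesis by (metis of_nat_eq_iff)
qed

lemma zero_count_cong: "zeros_in f D = zeros_in f D' \<Longrightarrow> zero_count f D = zero_count f D'"
  by (simp add: zero_count_def)

lemma exists_positive_below:
  fixes A :: "real set"
  assumes "finite A" "\<And>x. x \<in> A \<Longrightarrow> x > 0" "e > 0"
  obtains d where "d > 0" "d < e" "\<And>x. x \<in> A \<Longrightarrow> d < x"
proof -
  have "Min (insert e A) > 0" using assms by (subst Min_gr_iff) auto
  moreover have "Min (insert e A) / 2 < x" if "x \<in> insert e A" for x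
  proof -
    have "Min (insert e A) \<le> x" using that assms(1) by (intro Min_le) auto
    then show ?thesis using \<open>Min (insert e A) > 0\<close> by linarith
  qed
  ultimately show ?thesis using that[of "Min (insert e A) / 2"] by auto
qed

section \<open>Passage from the rectangle to the half-disc\<close>

context annulus_data
begin

text \<open>Neither \<open>F\<close> nor \<open>F'\<close> vanishes left of the line at distance
  between \<open>2a\<close> and \<open>10a\<close> from \<open>s1\<close>. As \<open>s0\<close> is
  within \<open>a\<close> of \<open>s1\<close>, the half-disc of radius \<open>6a\<close> about
  \<open>s0\<close> contains exactly the left zeros within \<open>2a\<close> of \<open>s1\<close>,
  and so does the rectangle.\<close>

lemma zero_count_deriv_eq:
  assumes s0: "dist s1 s0 \<le> a"
  defines "D \<equiv> {s. norm (s - s0) \<le> 6 * a \<and> Re s < 1/2}"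
  shows "finite (zeros_in F D)" "finite (zeros_in (deriv F) D)" "zero_count F D = zero_count (deriv F) D"
proof -
  define S where "S = ball s1 (10 * a)"
  have SU: "cball s1 (10 * a) \<subseteq> U" using in_U by auto
  have F': "deriv F holomorphic_on U" using F_holo by (intro holomorphic_deriv) auto
  \<comment> \<open>A point of the zero-free half-annulus, showing that neither \<open>F\<close> nor
    \<open>F'\<close> vanishes identically.\<close>
  define w where "w = s1 - of_real (3 * a)"
  have dw: "dist s1 w = 3 * a" using a by (simp add: w_def dist_norm)
  have Rw: "Re w < 1/2" using a by (simp add: w_def s1)
  have w: "F w \<noteq> 0" "deriv F w \<noteq> 0" "w \<in> U"
  proof -
    show "F w \<noteq> 0" "w \<in> U" using Re_logderiv_neg_annulus(1)[OF Rw] dw a in_U[of w] by auto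
    have "Re (deriv F w / F w) < 0" using Re_logderiv_neg_annulus(2)[OF Rw] dw a by auto
    then show "deriv F w \<noteq> 0" by auto
  qed
  have finF: "finite {z \<in> cball s1 (10 * a). F z = 0}"
    by (rule finite_zeros_compact[OF F_holo _ _ _ SU]) (use w in auto)
  have finF': "finite {z \<in> cball s1 (10 * a). deriv F z = 0}"
    by (rule finite_zeros_compact[OF F' _ _ _ SU]) (use w in auto)
  obtain e where e: "e > 0"
    "\<And>s. 1/2 - e < Re s \<Longrightarrow> Re s < 1/2 \<Longrightarrow> \<bar>Im s - T\<bar> \<le> 3 * a \<Longrightarrow> F s \<noteq> 0 \<and> Re (deriv F s / F s) < 0"
    using Re_logderiv_neg_near_line by blast
  define ZZ where "ZZ = {z \<in> cball s1 (10 * a). F z = 0} \<union> {z \<in> cball s1 (10 * a). deriv F z = 0}"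
  \<comment> \<open>Distances to the line of the finitely many zeros left of it; choosing
    \<open>d\<close> below all of them lets the rectangle stop short of the line without losing a
    zero.\<close>
  define X where "X = (\<lambda>z. 1/2 - Re z) ` {z \<in> ZZ. Re z < 1/2}"
  have "finite X" "\<And>x. x \<in> X \<Longrightarrow> x > 0" unfolding X_def ZZ_def using finF finF' by auto
  then obtain d where d: "d > 0" "d < min e a" "\<And>x. x \<in> X \<Longrightarrow> d < x"
    using exists_positive_below[of X "min e a"] e(1) a by auto
  define a1 a3 where "a1 = Complex (1/2 - 3 * a) (T - 3 * a)" and "a3 = Complex (1/2 - d) (T + 3 * a)"
  have box: "Re a1 \<le> Re a3" "Im a1 \<le> Im a3" using d a by (auto simp: a1_def a3_def)
  have dist_le: "dist s1 p \<le> \<bar>Re p - 1/2\<bar> + \<bar>Im p - T\<bar>" for p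
    using cmod_le[of "s1 - p"] by (simp add: dist_norm s1 abs_minus_commute)
  have cb: "dist s1 p \<le> 6 * a" "Re p < 1/2" "\<bar>Re p - 1/2\<bar> \<le> 3 * a" "\<bar>Im p - T\<bar> \<le> 3 * a" if "p \<in> cbox a1 a3" for p
  proof -
    show 1: "Re p < 1/2" "\<bar>Re p - 1/2\<bar> \<le> 3 * a" "\<bar>Im p - T\<bar> \<le> 3 * a"
      using that d(1) by (auto simp: in_cbox_complex_iff a1_def a3_def abs_le_iff)
    show "dist s1 p \<le> 6 * a" using dist_le[of p] 1 by linarith
  qed
  have boxS: "cbox a1 a3 \<subseteq> S" 
  proof
    fix p assume "p \<in> cbox a1 a3"
    then show "p \<in> S" using cb(1)[of p] a by (simp add: S_def)
  qed
  have path: "F p \<noteq> 0 \<and> Re (deriv F p / F p) < 0" if "p \<in> path_image (rectpath a1 a3)" for p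
  proof -
    have p: "p \<in> cbox a1 a3" "p \<notin> box a1 a3" using that path_image_rectpath_cbox_minus_box[OF box] by auto
    show ?thesis
    proof (cases "Re p = 1/2 - d")
      case True
      then show ?thesis using e(2)[of p] cb[OF p(1)] d by simp
    next
      case False
      then have "Re p = 1/2 - 3 * a \<or> \<bar>Im p - T\<bar> = 3 * a"
        using p a by (auto simp: in_box_complex_iff in_cbox_complex_iff a1_def a3_def abs_if)
      \<comment> \<open>The other three sides stay at distance at least \<open>3a\<close> from
        \<open>s1\<close>, inside the zero-free half-annulus.\<close>
      then have "3 * a \<le> \<bar>Re (s1 - p)\<bar> \<or> 3 * a \<le> \<bar>Im (s1 - p)\<bar>" using a by (auto simp: s1)
      then have "3 * a \<le> dist s1 p" 
        using abs_Re_le_cmod[of "s1 - p"] abs_Im_le_cmod[of "s1 - p"] unfolding dist_norm by linarith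
      then show ?thesis using Re_logderiv_neg_annulus[of p] cb[OF p(1)] a by auto
    qed
  qed
  have holS: "F holomorphic_on S" using F_holo SU unfolding S_def by (meson ball_subset_cball holomorphic_on_subset)
  have finS: "finite {z \<in> S. F z = 0}" "finite {z \<in> S. deriv F z = 0}"
    by (rule finite_subset[OF _ finF], force simp: S_def) (rule finite_subset[OF _ finF'], force simp: S_def)
  have eq: "zero_count F (box a1 a3) = zero_count (deriv F) (box a1 a3)"
    by (rule zero_count_deriv_rectangle[OF holS _ _ finS boxS box path]) (auto simp: S_def)
  have DZ: "zeros_in f D = zeros_in f (box a1 a3)" if f: "f = F \<or> f = deriv F" for f
  proof (intro equalityI subsetI)
    fix z assume "z \<in> zeros_in f D"
    then have z: "f z = 0" "norm (z - s0) \<le> 6 * a" "Re z < 1/2" by (auto simp: zeros_in_def D_def)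
    have "dist s1 z \<le> 10 * a" using z(2) s0 a dist_triangle[of s1 z s0] dist_norm[of z s0] dist_commute[of s0 z] by linarith
    moreover have "dist s1 z \<le> 2 * a"
      using Re_logderiv_neg_annulus[OF z(3) _ calculation] f z(1) by fastforce
    then have "\<bar>Re (s1 - z)\<bar> \<le> 2 * a" "\<bar>Im (s1 - z)\<bar> \<le> 2 * a"
      using abs_Re_le_cmod abs_Im_le_cmod order_trans unfolding dist_norm by blast+
    moreover have "d < 1/2 - Re z" using z f calculation by (intro d(3)) (auto simp: X_def ZZ_def)
    ultimately have "z \<in> box a1 a3" using a by (auto simp: in_box_complex_iff a1_def a3_def s1 abs_le_iff)
    then show "z \<in> zeros_in f (box a1 a3)" using z by (simp add: zeros_in_def)
  next
    fix z assume "z \<in> zeros_in f (box a1 a3)"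
    then have z: "f z = 0" "z \<in> cbox a1 a3" using box_subset_cbox by (auto simp: zeros_in_def)
    have "dist s1 z \<le> 2 * a"
      using Re_logderiv_neg_annulus[OF cb(2)[OF z(2)]] f z(1) cb(1)[OF z(2)] a by fastforce
    then have "norm (z - s0) \<le> 6 * a" using s0 a dist_triangle[of z s0 s1] by (simp add: dist_norm norm_minus_commute)
    then show "z \<in> zeros_in f D" using z cb(2)[OF z(2)] by (simp add: zeros_in_def D_def)
  qed
  show "zero_count F D = zero_count (deriv F) D" using eq zero_count_cong[OF DZ] by metis
  have "box a1 a3 \<subseteq> S" using boxS box_subset_cbox by blast
  then show "finite (zeros_in F D)" "finite (zeros_in (deriv F) D)"
    using DZ finS by (auto simp: zeros_in_def intro: rev_finite_subset)
qed

end

subsection \<open>Choice of the radius\<close>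

text \<open>Zeros off the line come in pairs at equal distance from \<open>s1\<close>, so an occupied annulus uses up
  two of them. This factor two is what makes the count work uniformly in \<open>A > \<epsilon>\<close>: for \<open>A\<close> close
  to \<open>\<epsilon>\<close> the largest admissible circles do not fit into the strip \<open>|t - T| \<le> 1/T\<close>.\<close>
lemma annulus_gap_pigeonhole:
  fixes R :: "nat \<Rightarrow> real" and Y Z :: "complex set"
  assumes "finite Z" "card Z < 2 * N" "antimono R" "Re s1 = 1/2"
    and Y: "\<And>z. z \<in> Y \<Longrightarrow> z \<in> Z \<and> 1 - cnj z \<in> Z \<and> Re z \<noteq> 1/2"
  shows "\<exists>j<N. \<forall>z\<in>Y. dist s1 z \<le> R (Suc j) \<or> dist s1 z \<ge> R j"
proof (rule ccontr)
  assume "\<not> ?thesis"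
  then have "\<forall>j\<in>{..<N}. \<exists>z. z \<in> Y \<and> R (Suc j) < dist s1 z \<and> dist s1 z < R j"
    by (auto simp: not_le)
  then obtain f where f: "\<And>j. j < N \<Longrightarrow> f j \<in> Y \<and> R (Suc j) < dist s1 (f j) \<and> dist s1 (f j) < R j"
    using bchoice[of "{..<N}"] by (metis lessThan_iff)
  \<comment> \<open>\<open>l\<close> selects the zero \<open>f j\<close> or its mirror image.
    Different annuli are disjoint, and a zero equal to its mirror image would lie on the line, so
    \<open>g\<close> is injective.\<close>
  define g where "g = (\<lambda>(j, l). if l then f j else 1 - cnj (f j))"
  have refl: "dist s1 (1 - cnj z) = dist s1 z" for z
    using assms(4) by (simp add: dist_norm cmod_def power2_eq_square algebra_simps)
  have gd: "R (Suc j) < dist s1 (g (j, l)) \<and> dist s1 (g (j, l)) < R j" if "j < N" for j l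
    using f[OF that] refl by (simp add: g_def)
  have "inj_on g ({..<N} \<times> UNIV)"
  proof (rule inj_onI)
    fix x y assume xy: "x \<in> {..<N} \<times> UNIV" "y \<in> {..<N} \<times> UNIV" "g x = g y"
    obtain i k j l where x: "x = (i, k)" "y = (j, l)" by (metis surj_pair)
    have ij: "i \<in> {..<N}" "j \<in> {..<N}" and eq: "g (i, k) = g (j, l)" using xy x by auto
    have "i = j"
    proof (rule ccontr)
      assume "i \<noteq> j"
      then consider "Suc i \<le> j" | "Suc j \<le> i" by linarith
      then show False
      proof cases
        case 1
        then have "R j \<le> R (Suc i)" using assms(3) by (rule antimonoD[rotated])
        then show False using gd[of i k] gd[of j l] ij eq by simp
      next
        case 2
        then have "R i \<le> R (Suc j)" using assms(3) by (rule antimonoD[rotated])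
        then show False using gd[of i k] gd[of j l] ij eq by simp
      qed
    qed
    moreover have "k = l"
    proof (rule ccontr)
      assume "k \<noteq> l"
      then have "f i = 1 - cnj (f i)" using eq \<open>i = j\<close> by (auto simp: g_def split: if_splits)
      then have "Re (f i) = 1/2" by (auto simp: complex_eq_iff)
      then show False using Y f ij(1) by blast
    qed
    ultimately show "x = y" using x by simp
  qed
  moreover have "g ` ({..<N} \<times> UNIV) \<subseteq> Z" using Y f by (auto simp: g_def)
  ultimately have "card ({..<N} \<times> (UNIV :: bool set)) \<le> card Z"
    using assms(1) by (rule card_inj_on_le)
  then show False using assms(2) by (simp add: card_cartesian_product)
qed

text \<open>\<open>N\<close> is the largest number of steps with
  \<open>C * ln T * \<kappa> ^ N \<le> T powr \<epsilon>\<close>. The factor \<open>C * ln T\<close>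
  uses up at most half of \<open>\<epsilon> * ln T\<close> on the logarithmic scale, so
  \<open>2 * N\<close> still exceeds the bound on the zeros.\<close>

lemma iterated_power_radii:
  fixes \<kappa> \<epsilon> T C A :: real
  assumes "\<kappa> > 2" "T > 1" "C * ln T \<ge> 1" "2 * ln (C * ln T) \<le> \<epsilon> * ln T"
  obtains N :: nat where "\<epsilon> / ln \<kappa> * ln T - 2 < 2 * real N"
    "T powr (A - \<epsilon>) * (C * ln T) * \<kappa> ^ N \<le> T powr A"
proof
  define D where "D = C * ln T"
  define N where "N = nat \<lfloor>(\<epsilon> * ln T - ln D) / ln \<kappa>\<rfloor>"
  have \<kappa>: "ln \<kappa> > 0" using assms by simp
  have D: "D \<ge> 1" "ln D \<ge> 0" using assms by (auto simp: D_def)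
  have nn: "(\<epsilon> * ln T - ln D) / ln \<kappa> \<ge> 0"
  proof (intro divide_nonneg_pos)
    show "0 \<le> \<epsilon> * ln T - ln D" using assms(4) D unfolding D_def[symmetric] by linarith
  qed (use \<kappa> in auto)
  then have N1: "real N \<le> (\<epsilon> * ln T - ln D) / ln \<kappa>" and N2: "(\<epsilon> * ln T - ln D) / ln \<kappa> < real N + 1"
    unfolding N_def by linarith+
  define X where "X = (\<epsilon> * ln T - ln D) / ln \<kappa>"
  have "\<epsilon> * ln T \<le> 2 * (\<epsilon> * ln T - ln D)" using assms(4) unfolding D_def[symmetric] by simp
  then have "\<epsilon> * ln T / ln \<kappa> \<le> 2 * (\<epsilon> * ln T - ln D) / ln \<kappa>" using \<kappa> by (intro divide_right_mono) auto
  also have "\<dots> = 2 * X" by (simp add: X_def)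
  finally have "\<epsilon> / ln \<kappa> * ln T \<le> 2 * X" by simp
  then show "\<epsilon> / ln \<kappa> * ln T - 2 < 2 * real N" using N2[folded X_def] by simp
  have "real N * ln \<kappa> \<le> \<epsilon> * ln T - ln D" using N1 \<kappa> by (simp add: field_simps)
  then have "ln (D * \<kappa> ^ N) \<le> ln (T powr \<epsilon>)"
    using D assms(1,2) by (simp add: ln_mult ln_realpow ln_powr)
  then have "D * \<kappa> ^ N \<le> T powr \<epsilon>" using D assms(1,2) by (subst (asm) ln_le_cancel_iff) auto
  then have "T powr (A - \<epsilon>) * (D * \<kappa> ^ N) \<le> T powr (A - \<epsilon>) * T powr \<epsilon>" by (intro mult_left_mono) auto
  also have "\<dots> = T powr A" by (simp flip: powr_add)
  finally show "T powr (A - \<epsilon>) * (C * ln T) * \<kappa> ^ N \<le> T powr A" by (simp add: D_def mult.assoc)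
qed

lemma eventually_height_conditions:
  fixes B c C \<epsilon> x1 x2 x3 x4 :: real
  assumes "c > 0" "C \<ge> 1" "\<epsilon> > 0"
  shows "\<forall>\<^sub>F T in at_top. x1 < T \<and> x2 < T \<and> x3 < T \<and> B * ln (2 * T) - ln c \<le> T / 792 \<and>
     2 * ln (C * ln T) \<le> \<epsilon> * ln T \<and> 50 < T"
proof -
  have C: "C > 0" using assms by simp
  have 1: "\<forall>\<^sub>F T in at_top. B * ln (2 * T) - ln c \<le> T / 792" by real_asymp
  have 2: "\<forall>\<^sub>F T in at_top. 2 * ln (C * ln T) \<le> \<epsilon> * ln T" using C assms(3) by real_asymp
  show ?thesis
    using eventually_gt_at_top[of x1] eventually_gt_at_top[of x2] eventually_gt_at_top[of x3] 1 2
      eventually_gt_at_top[of "50 :: real"] by eventually_elim auto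
qed

context completed_fn
begin

text \<open>The class bounds zeros with multiplicity, whereas the pigeonhole argument counts
  distinct points.\<close>

lemma card_le_zero_count:
  assumes "finite (zeros_in F D)" "1 \<notin> D" "\<exists>w. w \<noteq> 1 \<and> F w \<noteq> 0"
  shows "card (zeros_in F D) \<le> zero_count F D"
proof -
  have conn: "connected (- {1 :: complex})" by (intro connected_punctured_universe) auto
  have "(\<Sum>z\<in>zeros_in F D. 1) \<le> zero_count F D" unfolding zero_count_def
  proof (intro sum_mono)
    fix z assume z: "z \<in> zeros_in F D"
    then have "zorder F z > 0" using assms(2,3)
      by (intro zorder_pos_at_zero[OF F_holo _ conn]) (auto simp: zeros_in_def)
    then show "1 \<le> nat (zorder F z)" by simp
  qed
  then show ?thesis by simp
qed

end

section \<open>The annulus hypotheses at large height\<close>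

context subclass_data
begin

lemma zero_counts_agree:
  assumes F: "F \<in> Sbar"
    and T2: "T2 > T1" "\<And>F t. F \<in> Sbar \<Longrightarrow> t \<ge> T2 \<Longrightarrow> F (Complex (1/2) t) \<noteq> 0 \<Longrightarrow>
        Re (deriv F (Complex (1/2) t) / F (Complex (1/2) t)) \<le> - 1"
    and T: "T > T2 + 1" "T > Tbar" "T > 10 + 9 * \<sigma>\<^sub>1" "T > 50"
      "B * ln (2 * T) - ln c \<le> T / 792" "2 * ln ((1 + 2 / \<delta>) * ln T) \<le> \<epsilon> * ln T"
    and "A > \<epsilon>" and \<sigma>\<^sub>0: "1/2 - exp (- (T powr A)) < \<sigma>\<^sub>0" "\<sigma>\<^sub>0 \<le> 1/2"
  shows "\<exists>\<rho>. exp (- (T powr A)) \<le> \<rho> \<and> \<rho> \<le> exp (- (T powr (A - \<epsilon>))) \<and>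
        (let D = {s. norm (s - Complex \<sigma>\<^sub>0 T) \<le> \<rho> \<and> Re s < 1 / 2} in
           finite (zeros_in F D) \<and> finite (zeros_in (deriv F) D) \<and>
           zero_count F D = zero_count (deriv F) D)"
proof -
  obtain Q \<omega> where "completed_fn r lam mu T1 F Q \<omega>" using Sbar_completed[OF F] .
  then interpret completed_fn r lam mu T1 F Q \<omega> .
  \<comment> \<open>\<open>C\<close> is determined by \<open>\<delta> * C = \<delta> + 2\<close>: it
    turns \<open>exp (- \<delta> * L j)\<close>, the quotient of the inner radius by the square of
    the outer one, into at most \<open>T powr (- 2 - \<delta>)\<close>.\<close>
  define \<kappa> C where "\<kappa> = 2 + \<delta>" and "C = 1 + 2 / \<delta>"
  have \<kappa>: "\<kappa> > 2" and C: "C \<ge> 1" using params by (auto simp: \<kappa>_def C_def)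
  have lnT: "ln T \<ge> 1" using exp_le T(4) by (subst ln_ge_iff) auto
  have ClnT: "C * ln T \<ge> 1" using C lnT mult_mono[of 1 C 1 "ln T"] by simp
  obtain N where N: "\<epsilon> / ln \<kappa> * ln T - 2 < 2 * real N"
    "T powr (A - \<epsilon>) * (C * ln T) * \<kappa> ^ N \<le> T powr A"
    using iterated_power_radii[OF \<kappa> _ ClnT T(6)[folded C_def], of A] T(4) by force
  define L where "L = (\<lambda>j. T powr (A - \<epsilon>) * (C * ln T) * \<kappa> ^ j)"
  define R where "R = (\<lambda>j. exp (- L j))"
  define s1 where "s1 = Complex (1/2) T"
  define c0 where "c0 = Complex \<sigma>\<^sub>1 T"
  have Fc0: "norm (F c0) \<ge> c" unfolding c0_def by (rule Sbar_lower[OF F])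
  have c01: "c0 \<noteq> 1" using T(4) by (simp add: c0_def complex_eq_iff)
  have nz: "\<exists>w. w \<noteq> 1 \<and> F w \<noteq> 0" using Fc0 params c01 by force
  have L0: "L 0 \<ge> C * ln T * (T powr (A - \<epsilon>))" by (simp add: L_def)
  have pw: "T powr (A - \<epsilon>) \<ge> 1" using \<open>A > \<epsilon>\<close> T(4) by (intro ge_one_powr_ge_zero) auto
  have Lmono: "mono L"
    unfolding L_def using \<kappa> pw ClnT by (intro monoI mult_left_mono power_increasing) auto
  have L_ge: "L j \<ge> C * ln T" "L j \<ge> T powr (A - \<epsilon>)" for j
  proof -
    have "L 0 \<le> L j" using Lmono by (rule monoD) simp
    moreover have "C * ln T * 1 \<le> C * ln T * T powr (A - \<epsilon>)" using pw ClnT by (intro mult_left_mono) auto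
    moreover have "1 * T powr (A - \<epsilon>) \<le> C * ln T * T powr (A - \<epsilon>)" using pw ClnT by (intro mult_right_mono) auto
    ultimately show "L j \<ge> C * ln T" "L j \<ge> T powr (A - \<epsilon>)" using L0 by linarith+
  qed
  have LSuc: "L (Suc j) = \<kappa> * L j" for j by (simp add: L_def)
  have "antimono R" unfolding R_def using Lmono by (auto simp: monotone_on_def)
  have R_le: "R j \<le> exp (- (C * ln T))" for j using L_ge by (simp add: R_def)
  \<comment> \<open>Because \<open>C \<ge> 1\<close>, even the largest circle fits into the strip in
    which the class bounds the zeros.\<close>
  have expC: "exp (- (C * ln T)) \<le> 1 / T"
  proof -
    have "exp (- (C * ln T)) \<le> exp (- ln T)" using mult_right_mono[of 1 C "ln T"] C lnT by simp
    also have "\<dots> = 1 / T" using T(4) by (simp add: exp_minus inverse_eq_divide)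
    finally show ?thesis .
  qed
  have R_T: "R j \<le> 1 / T" for j using R_le expC order_trans by blast
  have T1T: "T1 < T - 1" using T(1) T2(1) by simp
  have near: "\<bar>Im z - T\<bar> \<le> dist s1 z" "\<bar>Re z - 1/2\<bar> \<le> dist s1 z" for z
    using abs_Im_le_cmod[of "s1 - z"] abs_Re_le_cmod[of "s1 - z"] by (simp_all add: dist_norm s1_def abs_minus_commute)
  have refl: "dist s1 (1 - cnj z) = dist s1 z" for z
    by (simp add: s1_def dist_norm cmod_def power2_eq_square algebra_simps)
  define strip where "strip = {s. \<bar>Im s - T\<bar> \<le> 1 / T}"
  define Y where "Y = {z. F z = 0 \<and> Re z \<noteq> 1/2 \<and> dist s1 z < R 0}"
  have strip: "finite (zeros_in F strip)" "real (zero_count F strip) \<le> \<epsilon> / ln \<kappa> * ln T - 2"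
    using F T(2) unfolding selberg_subclass_def strip_def \<kappa>_def by auto
  have T_inv: "1 / T < 1/2" using T(4) by simp
  have "1 / T < T" using T(4) T_inv by linarith
  then have "1 \<notin> strip" using T(4) by (simp add: strip_def)
  then have "card (zeros_in F strip) \<le> zero_count F strip" using card_le_zero_count strip nz by blast
  then have "real (card (zeros_in F strip)) < real (2 * N)" using strip(2) N(1) by simp
  then have card: "card (zeros_in F strip) < 2 * N" by (simp only: of_nat_less_iff)
  have "\<exists>j<N. \<forall>z\<in>Y. dist s1 z \<le> R (Suc j) \<or> dist s1 z \<ge> R j"
  proof (rule annulus_gap_pigeonhole[OF strip(1) card \<open>antimono R\<close>])
    show "Re s1 = 1/2" by (simp add: s1_def)
    fix z assume z: "z \<in> Y"
    then have d: "\<bar>Im z - T\<bar> \<le> 1 / T" using near(1)[of z] R_T[of 0] by (auto simp: Y_def)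
    then have "Im z \<ge> T1" using T1T T_inv by linarith
    then have "F (1 - cnj z) = 0" using zero_symmetric z by (simp add: Y_def)
    then show "z \<in> zeros_in F strip \<and> 1 - cnj z \<in> zeros_in F strip \<and> Re z \<noteq> 1/2"
      using z d by (simp add: Y_def zeros_in_def strip_def)
  qed
  then obtain j where j: "j < N" "\<And>z. z \<in> Y \<Longrightarrow> dist s1 z \<le> R (Suc j) \<or> dist s1 z \<ge> R j" by blast
  define a b where "a = R (Suc j)" and "b = R j"
  have a_lower: "a \<ge> exp (- (T powr A))"
  proof -
    have "L (Suc j) \<le> L N" using Lmono by (rule monoD) (use j(1) in simp)
    also have "\<dots> \<le> T powr A" unfolding L_def by (rule N(2))
    finally show ?thesis by (simp add: a_def R_def)
  qed
  have b0: "b > 0" "a > 0" by (auto simp: a_def b_def R_def)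
  have bT: "b \<le> 1 / T" unfolding b_def by (rule R_T)
  have ab: "a * T\<^sup>2 \<le> b\<^sup>2"
  proof -
    have "\<delta> * (C * ln T) \<le> \<delta> * L j" using L_ge params by (intro mult_left_mono) auto
    moreover have "\<delta> * (C * ln T) = \<delta> * ln T + 2 * ln T" using params by (simp add: C_def field_simps)
    moreover have "0 \<le> \<delta> * ln T" using params lnT by simp
    ultimately have "2 * ln T - \<kappa> * L j \<le> - 2 * L j" by (simp add: \<kappa>_def algebra_simps)
    then have "exp (2 * ln T - \<kappa> * L j) \<le> exp (- 2 * L j)" by simp
    moreover have "exp (2 * ln T - \<kappa> * L j) = a * T\<^sup>2"
    proof -
      have "exp (2 * ln T) = T\<^sup>2" using T(4) by (simp add: exp_double)
      then show ?thesis by (simp add: a_def R_def LSuc exp_diff exp_minus field_simps)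
    qed
    moreover have "exp (- 2 * L j) = b\<^sup>2" by (simp add: b_def R_def flip: exp_double)
    ultimately show ?thesis by simp
  qed
  have a20: "20 * a < b"
  proof -
    have "a * T\<^sup>2 \<le> b * (1 / T)" using ab bT b0 mult_left_mono[of b "1/T" b] by (simp add: power2_eq_square)
    also have "\<dots> < b * 1" using b0 T(4) by (intro mult_strict_left_mono) auto
    finally have "a * T\<^sup>2 < b" by simp
    moreover have "20 \<le> T\<^sup>2" using T(4) power_mono[of 50 T 2] by simp
    ultimately show ?thesis using mult_left_mono[of 20 "T\<^sup>2" a] b0 by linarith
  qed
  have b_half: "b \<le> 1/2" using bT T_inv by simp
  \<comment> \<open>This makes the bound \<open>792 * K / R1\<^sup>2\<close> at most
    \<open>T\<close>. A linear bound in place of a logarithmic one suffices, as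
    \<open>a * T / b\<^sup>2\<close> is at most \<open>1 / T\<close>.\<close>
  define K where "K = T / 792"
  \<comment> \<open>\<open>2/3 * R1 = \<sigma>\<^sub>1\<close> just reaches the disc of radius 1/2
    about \<open>s1\<close>, while \<open>3 * R1\<close> keeps
    \<open>Re z \<ge> - 7/2 * \<sigma>\<^sub>1\<close>, within the range of the growth
    bound.\<close>
  define R1 where "R1 = 3 / 2 * \<sigma>\<^sub>1"
  have R1: "R1 > 0" "R1\<^sup>2 \<ge> 1" using params one_le_power[of R1 2] by (auto simp: R1_def)
  have K0: "K > 0" using T(4) by (simp add: K_def)
  define Z where "Z = {z \<in> cball c0 R1. F z = 0}"
  have Imc: "\<bar>Im z - T\<bar> \<le> dist c0 z" "\<bar>Re z - \<sigma>\<^sub>1\<bar> \<le> dist c0 z" for z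
    using abs_Im_le_cmod[of "c0 - z"] abs_Re_le_cmod[of "c0 - z"] by (simp_all add: dist_norm c0_def abs_minus_commute)
  have big: "cball c0 (3 * R1) \<subseteq> - {1}"
  proof
    fix z assume "z \<in> cball c0 (3 * R1)"
    then have "Im z > 0" using Imc(1)[of z] T(3) params by (simp add: R1_def)
    then show "z \<in> - {1}" by auto
  qed
  have upper: "norm (F z) \<le> (2 * T) powr B" if "z \<in> sphere c0 (3 * R1)" for z
  proof -
    have "norm (F z) < Im z powr B"
      using that Imc[of z] T(3) params by (intro Sbar_bound[OF F]) (simp_all add: R1_def)
    also have "\<dots> \<le> (2 * T) powr B"
      using that Imc(1)[of z] T(3) params by (intro powr_mono2) (simp_all add: R1_def)
    finally show ?thesis by simp
  qed
  have lnK: "ln ((2 * T) powr B / c) \<le> K"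
    using T(4,5) params by (simp add: K_def ln_div ln_powr)
  have conn: "connected (- {1 :: complex})" by (intro connected_punctured_universe) auto
  note expansion = logderiv_local_expansion[OF F_holo _ conn big R1(1) params(2) Fc0 upper K0 lnK Z_def]
  have fin: "finite Z" by (rule expansion(1)) auto
  have ZK: "ln 2 * (\<Sum>\<rho>\<in>Z. nat (zorder F \<rho>)) \<le> K" by (rule expansion(2)) auto
  obtain q where q: "q holomorphic_on ball c0 R1"
    "\<And>z. z \<in> ball c0 R1 \<Longrightarrow> F z \<noteq> 0 \<Longrightarrow>
       deriv F z / F z = (\<Sum>\<rho>\<in>Z. of_nat (nat (zorder F \<rho>)) / (z - \<rho>)) + q z"
    "\<And>z. z \<in> cball c0 (2 / 3 * R1) \<Longrightarrow> norm (deriv q z) \<le> 792 * K / R1\<^sup>2"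
    using expansion(3) by blast
  have ball: "ball s1 (1/2) \<subseteq> cball c0 (2 / 3 * R1)" "ball s1 (1/2) \<subseteq> ball c0 R1"
  proof -
    have "dist c0 s1 = \<sigma>\<^sub>1 - 1/2" using params by (simp add: c0_def s1_def dist_norm cmod_def)
    then have "dist c0 z < \<sigma>\<^sub>1" if "z \<in> ball s1 (1/2)" for z
      using that dist_triangle[of c0 z s1] by simp
    then show "ball s1 (1/2) \<subseteq> cball c0 (2 / 3 * R1)" "ball s1 (1/2) \<subseteq> ball c0 R1"
      using params by (force simp: R1_def)+
  qed
  interpret annulus_data F T s1 Z "\<lambda>\<rho>. nat (zorder F \<rho>)" q a b T T
  proof
    show "s1 = Complex (1/2) T" by (rule s1_def)
    have "ball s1 (1/2) \<subseteq> - {1}" using ball(2) big R1(1) by force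
    then show "F holomorphic_on ball s1 (1/2)" using F_holo by (rule holomorphic_on_subset[rotated])
    show "finite Z" by (rule fin)
    show "z \<in> Z" if "z \<in> ball s1 (1/2)" "F z = 0" for z
      using subsetD[OF ball(2) that(1)] that(2) by (simp add: Z_def)
    show "q holomorphic_on ball s1 (1/2)" using q(1) ball(2) by (rule holomorphic_on_subset)
    show "norm (deriv q z) \<le> T" if "z \<in> ball s1 (1/2)" for z
    proof -
      have "norm (deriv q z) \<le> T / R1\<^sup>2" using q(3) ball(1) that by (force simp: K_def)
      also have "\<dots> \<le> T / 1" using R1(2) T(4) by (intro divide_left_mono) auto
      finally show ?thesis by simp
    qed
    show "real (\<Sum>\<rho>\<in>Z. nat (zorder F \<rho>)) \<le> T"
    proof -
      have "ln 2 * 2 \<ge> (1 :: real)" using ln2_ge_two_thirds by simp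
      then have "1 * real (\<Sum>\<rho>\<in>Z. nat (zorder F \<rho>)) \<le> ln 2 * 2 * real (\<Sum>\<rho>\<in>Z. nat (zorder F \<rho>))"
        by (intro mult_right_mono of_nat_0_le_iff)
      then show ?thesis using ZK T(4) by (simp add: K_def)
    qed
    show "deriv F z / F z = (\<Sum>\<rho>\<in>Z. of_nat (nat (zorder F \<rho>)) / (z - \<rho>)) + q z"
      if "z \<in> ball s1 (1/2)" "F z \<noteq> 0" for z using q(2) ball(2) that by blast
    \<comment> \<open>\<open>Z\<close> lives in a disc about \<open>c0\<close>, which is not
      symmetric about the critical line; closure under reflection comes from the smaller disc about
      \<open>s1\<close>.\<close>
    show "1 - cnj z \<in> Z \<and> nat (zorder F (1 - cnj z)) = nat (zorder F z)" if "z \<in> Z" "dist s1 z \<le> a" for z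
    proof -
      have d: "dist s1 z < 1/2" using that a20 b_half b0 by linarith
      then have Im: "Im z > T1" using near(1)[of z] T1T by linarith
      have "1 - cnj z \<in> ball s1 (1/2)" using d refl by simp
      then have "1 - cnj z \<in> cball c0 R1" using ball(2) by force
      moreover have "F (1 - cnj z) = 0" using zero_symmetric[of z] Im that(1) by (simp add: Z_def)
      ultimately show ?thesis using zorder_symmetric[OF Im nz] by (simp add: Z_def)
    qed
    show "dist s1 z \<le> a \<or> dist s1 z \<ge> b" if "z \<in> Z" "Re z \<noteq> 1/2" for z
    proof (cases "dist s1 z < b")
      case True
      also have "b \<le> R 0" unfolding b_def using \<open>antimono R\<close> by (rule antimonoD) simp
      finally have "z \<in> Y" using that by (simp add: Y_def Z_def)
      then show ?thesis using j(2) by (simp add: a_def b_def)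
    qed simp
    show "Re (deriv F (Complex (1/2) t) / F (Complex (1/2) t)) \<le> - 1"
      if "\<bar>t - T\<bar> < 1/2" "F (Complex (1/2) t) \<noteq> 0" for t
    proof (rule T2(2)[OF F _ that(2)])
      show "t \<ge> T2" using that(1) T(1) by linarith
    qed
    \<comment> \<open>Multiplied by \<open>b\<^sup>2\<close> the left side is at most
      \<open>50 * a * T\<close>, which is below \<open>a * T\<^sup>2 \<le> b\<^sup>2\<close> since
      \<open>T > 50\<close>.\<close>
    show "10 * a * (4 * T / b\<^sup>2 + T) < 1"
    proof -
      have "b\<^sup>2 \<le> 1" using b0 b_half by (simp add: power_le_one)
      then have "T * b\<^sup>2 \<le> T * 1" using T(4) by (intro mult_left_mono) auto
      then have "(4 * T / b\<^sup>2 + T) * b\<^sup>2 \<le> 5 * T" using b0 by (simp add: distrib_right)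
      then have "10 * a * ((4 * T / b\<^sup>2 + T) * b\<^sup>2) \<le> 10 * a * (5 * T)" using b0 by (intro mult_left_mono) auto
      also have "\<dots> = 50 * (a * T)" by simp
      also have "\<dots> < T * (a * T)" using T(4) b0 by (intro mult_strict_right_mono mult_pos_pos) auto
      also have "\<dots> \<le> b\<^sup>2 * 1" using ab by (simp add: power2_eq_square mult_ac)
      finally have "b\<^sup>2 * (10 * a * (4 * T / b\<^sup>2 + T)) < b\<^sup>2 * 1" by (simp add: mult_ac)
      then show ?thesis using b0 by (subst (asm) mult_less_cancel_left_pos) auto
    qed
  qed (use b0 a20 b_half in auto)
  have "dist s1 (Complex \<sigma>\<^sub>0 T) \<le> a"
    using \<sigma>\<^sub>0 a_lower by (simp add: s1_def dist_norm cmod_def)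
  note count = zero_count_deriv_eq[OF this]
  \<comment> \<open>The radius of the theorem is \<open>6 * a\<close>; it stays below the upper
    limit because \<open>20 * a < b\<close>.\<close>
  have "6 * a \<le> exp (- (T powr (A - \<epsilon>)))"
  proof -
    have "b \<le> exp (- (T powr (A - \<epsilon>)))" using L_ge(2)[of j] by (simp add: b_def R_def)
    then show ?thesis using a20 b0 by simp
  qed
  moreover have "exp (- (T powr A)) \<le> 6 * a" using a_lower b0 by simp
  ultimately show ?thesis using count unfolding Let_def by blast
qed

end

theorem theorem2:
  fixes \<sigma>\<^sub>1 c B \<epsilon> \<delta> Tbar :: real
    and r :: nat and lam :: "nat \<Rightarrow> real" and mu :: "nat \<Rightarrow> complex"
  assumes "\<sigma>\<^sub>1 > 1" "c > 0" "B > 0" "\<epsilon> > 0" "\<delta> > 0" "Tbar > 0"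
    and "\<And>j. j \<in> {1..r} \<Longrightarrow> lam j > 0"
    and "\<And>j. j \<in> {1..r} \<Longrightarrow> Re (mu j) > 0"
  shows "\<exists>T\<^sub>0>0. \<forall>F \<in> selberg_subclass \<sigma>\<^sub>1 c B \<epsilon> \<delta> Tbar r lam mu. selberg_degree r lam > 0 \<longrightarrow>
    (\<forall>A \<sigma>\<^sub>0 T. A > \<epsilon> \<and> T > T\<^sub>0 \<and> 1 / 2 - exp (- (T powr A)) < \<sigma>\<^sub>0 \<and> \<sigma>\<^sub>0 \<le> 1 / 2 \<longrightarrow>
      (\<exists>\<rho>. exp (- (T powr A)) \<le> \<rho> \<and> \<rho> \<le> exp (- (T powr (A - \<epsilon>))) \<and>
        (let D = {s. norm (s - Complex \<sigma>\<^sub>0 T) \<le> \<rho> \<and> Re s < 1 / 2} in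
           finite (zeros_in F D) \<and> finite (zeros_in (deriv F) D) \<and>
           zero_count F D = zero_count (deriv F) D)))"
proof (cases "selberg_degree r lam > 0")
  \<comment> \<open>The degree is computed from the fixed data, not from \<open>F\<close>, so this
    case is vacuous for all \<open>F\<close> at once and any positive height serves.\<close>
  case False
  then show ?thesis by (intro exI[of _ 1]) auto
next
  case True
  then have deg: "(\<Sum>j\<in>{1..r}. lam j) > 0" by (simp add: selberg_degree_def)
  obtain T1 where "gamma_data r lam mu T1" using gamma_data_exists assms(7,8) by blast
  then interpret gamma_data r lam mu T1 .
  interpret subclass_data r lam mu T1 \<sigma>\<^sub>1 c B \<epsilon> \<delta> Tbar by unfold_locales (use assms in auto)
  obtain T2 where T2: "T2 > T1" 
    "\<And>F t. F \<in> Sbar \<Longrightarrow> t \<ge> T2 \<Longrightarrow> F (Complex (1/2) t) \<noteq> 0 \<Longrightarrow>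
        Re (deriv F (Complex (1/2) t) / F (Complex (1/2) t)) \<le> - 1"
    using Re_logderiv_on_line_le[OF deg] by blast
  have "1 + 2 / \<delta> \<ge> 1" using assms by simp
  from eventually_height_conditions[OF assms(2) this assms(4), of "T2 + 1" Tbar "10 + 9 * \<sigma>\<^sub>1" B]
  obtain T0 where T0: "\<And>T. T \<ge> T0 \<Longrightarrow> T2 + 1 < T \<and> Tbar < T \<and> 10 + 9 * \<sigma>\<^sub>1 < T \<and> 
     B * ln (2 * T) - ln c \<le> T / 792 \<and> 2 * ln ((1 + 2 / \<delta>) * ln T) \<le> \<epsilon> * ln T \<and> 50 < T"
    unfolding eventually_at_top_linorder by blast
  show ?thesis
  proof (rule exI[of _ "max T0 1"], intro conjI ballI impI allI; (elim conjE)?)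
    fix F A \<sigma>\<^sub>0 T
    assume F: "F \<in> Sbar" and "\<epsilon> < A" and T: "T > max T0 1"
      and \<sigma>\<^sub>0: "1/2 - exp (- (T powr A)) < \<sigma>\<^sub>0" "\<sigma>\<^sub>0 \<le> 1/2"
    have "T \<ge> T0" using T by simp
    from T0[OF this] show "\<exists>\<rho>. exp (- (T powr A)) \<le> \<rho> \<and> \<rho> \<le> exp (- (T powr (A - \<epsilon>))) \<and>
        (let D = {s. norm (s - Complex \<sigma>\<^sub>0 T) \<le> \<rho> \<and> Re s < 1 / 2} in
           finite (zeros_in F D) \<and> finite (zeros_in (deriv F) D) \<and>
           zero_count F D = zero_count (deriv F) D)"
      by (intro zero_counts_agree[OF F T2 _ _ _ _ _ _ \<open>\<epsilon> < A\<close> \<sigma>\<^sub>0]) auto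
  qed simp
qed

end
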